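(* Let $n\geq 1$ and $\sigma\in S_n$. The graph $\mathcal{B}(\sigma)$ is planar if and only if $\sigma$ avoids all of the permutations in the following list: $\{321$, $3412$, $23451$, $23514$, $24153$, $25134$, $31452$, $31524$, $41253$, $51234$, $234165$, $231564$, $231645$, $241365$, $214563$, $214635$, $215364$, $216345$, $314265$, $312564$, $312645$, $412365$, $2315476$, $2143675$, $2143756$, $2145376$, $2153476$, $3125476$, $21436587\}$.
   Context: Permutations are written in one-line notation. The length $\ell(\pi)$ of $\pi\in S_n$ is the minimum number of adjacent transpositions $(i\ i+1)$ whose product is $\pi$; equivalently, it is the number of inversions, i.e. pairs $i<j$ with $\pi(i)>\pi(j)$. For $\sigma,\tau\in S_n$ write $\sigma\prec\tau$ if $\ell(\sigma)<\ell(\tau)$ and there is a transposition $t=(i\ j)$ (not necessarily adjacent) with $\sigma=\tau t$. Bruhat order $\leq$ on $S_n$ is the reflexive transitive closure of $\prec$. The Bruhat graph of $S_n$ is the directed graph with vertex set $S_n$ and an edge $\sigma\to\tau$ whenever $\sigma\prec\tau$ (the difference $\ell(\tau)-\ell(\sigma)$ need not be $1$). For $\pi\in S_n$, the Bruhat graph $\mathcal{B}(\pi)$ is the induced subgraph on the vertices $\sigma\in S_n$ with $\sigma\leq\pi$ in Bruhat order. For $\pi\in S_k$ and $\tau\in S_n$ with $k\leq n$, $\tau$ contains $\pi$ if there are indices $1\leq i_1<\cdots<i_k\leq n$ such that for all $a,b$, $\tau(i_a)<\tau(i_b)$ if and only if $\pi(a)<\pi(b)$; otherwise (or if $k>n$)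 $\tau$ avoids $\pi$. A graph is planar if it can be drawn in the plane without edges crossing; for $\mathcal{B}(\sigma)$ this refers to the underlying undirected graph. *)

theory Defs
  imports
    "HOL-Analysis.Analysis"
    "HOL-Combinatorics.Permutations"
    "Graph_Theory.Digraph_Component"
begin

section \<open>Length and Bruhat order\<close>

text \<open>
  The elements of $S_n$ are the functions \<open>\<pi>\<close> with \<open>\<pi> permutes {1..n}\<close>, multiplied by
  composition.  The notions below therefore carry \<open>n\<close> as a parameter.
\<close>

definition perm_length :: "nat \<Rightarrow> (nat \<Rightarrow> nat) \<Rightarrow> nat" where
  "perm_length n \<pi> = (LEAST k. \<exists>is. length is = k \<and> set is \<subseteq> {1..<n} \<and>
     \<pi> = foldr (\<circ>) (map (\<lambda>i. Transposition.transpose i (Suc i)) is) id)"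

definition bruhat_step :: "nat \<Rightarrow> (nat \<Rightarrow> nat) \<Rightarrow> (nat \<Rightarrow> nat) \<Rightarrow> bool" where
  "bruhat_step n \<sigma> \<tau> \<longleftrightarrow> \<sigma> permutes {1..n} \<and> \<tau> permutes {1..n} \<and>
     perm_length n \<sigma> < perm_length n \<tau> \<and>
     (\<exists>i\<in>{1..n}. \<exists>j\<in>{1..n}. i \<noteq> j \<and> \<sigma> = \<tau> \<circ> Transposition.transpose i j)"

definition bruhat_le :: "nat \<Rightarrow> (nat \<Rightarrow> nat) \<Rightarrow> (nat \<Rightarrow> nat) \<Rightarrow> bool" where
  "bruhat_le n = (bruhat_step n)\<^sup>*\<^sup>*"

section \<open>Bruhat graphs\<close>

definition bruhat_graph ::
  "nat \<Rightarrow> (nat \<Rightarrow> nat, (nat \<Rightarrow> nat) \<times> (nat \<Rightarrow> nat)) pre_digraph" where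
  "bruhat_graph n = \<lparr>verts = {\<sigma>. \<sigma> permutes {1..n}},
     arcs = {(\<sigma>, \<tau>). bruhat_step n \<sigma> \<tau>}, tail = fst, head = snd\<rparr>"

definition bruhat_graph_below ::
  "nat \<Rightarrow> (nat \<Rightarrow> nat) \<Rightarrow> (nat \<Rightarrow> nat, (nat \<Rightarrow> nat) \<times> (nat \<Rightarrow> nat)) pre_digraph" where
  "bruhat_graph_below n \<pi> = bruhat_graph n \<restriction> {\<sigma>. \<sigma> permutes {1..n} \<and> bruhat_le n \<sigma> \<pi>}"

section \<open>Planarity\<close>

text \<open>
  Edges of the underlying simple undirected graph.  Loops and multiplicities, which do not occur
  in Bruhat graphs and never affect planarity, are dropped.
\<close>

definition undirected_edges :: "('a, 'b) pre_digraph \<Rightarrow> 'a set set" where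
  "undirected_edges G = {{u, v} | u v. (u, v) \<in> arcs_ends G \<and> u \<noteq> v}"

text \<open>
  A drawing places the vertices at distinct points \<open>p v\<close> of the plane and draws each edge \<open>e\<close> as
  an arc \<open>\<gamma> e\<close> joining the points of its ends.  An edge passes through no other vertex, and two
  distinct edges meet only at the points of their common ends.
\<close>

definition plane_drawing ::
  "('a, 'b) pre_digraph \<Rightarrow> ('a \<Rightarrow> complex) \<Rightarrow> ('a set \<Rightarrow> real \<Rightarrow> complex) \<Rightarrow> bool" where
  "plane_drawing G p \<gamma> \<longleftrightarrow>
     inj_on p (verts G) \<and>
     (\<forall>e\<in>undirected_edges G. arc (\<gamma> e) \<and>
        {pathstart (\<gamma> e), pathfinish (\<gamma> e)} = p ` e \<and>
        path_image (\<gamma> e) \<inter> p ` verts G = p ` e) \<and>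
     (\<forall>e\<in>undirected_edges G. \<forall>f\<in>undirected_edges G. e \<noteq> f \<longrightarrow>
        path_image (\<gamma> e) \<inter> path_image (\<gamma> f) = p ` (e \<inter> f))"

definition planar :: "('a, 'b) pre_digraph \<Rightarrow> bool" where
  "planar G \<longleftrightarrow> (\<exists>p \<gamma>. plane_drawing G p \<gamma>)"

section \<open>Pattern avoidance\<close>

definition one_line :: "nat list \<Rightarrow> nat \<Rightarrow> nat" where
  "one_line xs i = (if i \<in> {1..length xs} then xs ! (i - 1) else i)"

text \<open>
  Containment of \<open>\<pi>\<close> in $S_k$ by \<open>\<tau>\<close> in $S_n$; for \<open>k > n\<close> no strictly increasing choice of
  indices exists.
\<close>

definition contains_pattern :: "nat \<Rightarrow> (nat \<Rightarrow> nat) \<Rightarrow> nat \<Rightarrow> (nat \<Rightarrow> nat) \<Rightarrow> bool" where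
  "contains_pattern n \<tau> k \<pi> \<longleftrightarrow>
     (\<exists>\<iota>. strict_mono_on {1..k} \<iota> \<and> \<iota> ` {1..k} \<subseteq> {1..n} \<and>
       (\<forall>a\<in>{1..k}. \<forall>b\<in>{1..k}. \<tau> (\<iota> a) < \<tau> (\<iota> b) \<longleftrightarrow> \<pi> a < \<pi> b))"

definition avoids :: "nat \<Rightarrow> (nat \<Rightarrow> nat) \<Rightarrow> nat list \<Rightarrow> bool" where
  "avoids n \<tau> xs \<longleftrightarrow> \<not> contains_pattern n \<tau> (length xs) (one_line xs)"

end

theory Submission
  imports Defs
begin

text \<open>
  If \<open>\<sigma>\<close> contains 321, the six rearrangements of the three values involved lie below \<open>\<sigma>\<close> and span a
  \<open>K\<^bsub>3,3\<^esub>\<close>, since every even one differs from every odd one by a transposition.  If \<open>\<sigma>\<close> contains 3412,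
  exchanging the 3 and the 1 gives a permutation below \<open>\<sigma>\<close> that contains 321.  Otherwise \<open>\<sigma>\<close> is a
  product of distinct adjacent transpositions; by the strong exchange property the permutations
  below \<open>\<sigma>\<close> are the products of the subwords, and the word can be read off from the initial segments
  that the product does not preserve, so \<open>\<B>(\<sigma>)\<close> is a hypercube of dimension \<open>\<ell>(\<sigma>)\<close>.  It is planar
  exactly if \<open>\<ell>(\<sigma>) \<le> 3\<close>, because the 4-cube has a \<open>K\<^bsub>3,3\<^esub>\<close> minor.  The remaining 27 patterns are the
  products of four distinct adjacent transpositions without superfluous fixed points, one for each
  choice, for every two consecutive letters, of not adjacent, adjacent in increasing order or
  adjacent in decreasing order.

  That \<open>K\<^bsub>3,3\<^esub>\<close> is not planar follows from the Jordan curve theorem: no face of a theta graph, formed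
  by three arcs with common ends, has interior points of all three arcs on its boundary.
\<close>

section \<open>Theta graphs in the plane\<close>

hide_const (open) Digraph_Component.connected

definition theta :: "(real \<Rightarrow> complex) \<Rightarrow> (real \<Rightarrow> complex) \<Rightarrow> (real \<Rightarrow> complex) \<Rightarrow> complex \<Rightarrow> complex \<Rightarrow> bool" where
  "theta c1 c2 c3 a b \<longleftrightarrow> a \<noteq> b \<and>
     (\<forall>c\<in>{c1, c2, c3}. arc c \<and> pathstart c = a \<and> pathfinish c = b) \<and>
     path_image c1 \<inter> path_image c2 = {a, b} \<and>
     path_image c1 \<inter> path_image c3 = {a, b} \<and>
     path_image c2 \<inter> path_image c3 = {a, b}"

lemma theta_rotate: "theta c1 c2 c3 a b \<Longrightarrow> theta c2 c3 c1 a b"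
  by (auto simp: theta_def)

text \<open>Traversing \<open>c\<close> and then \<open>d\<close> backwards gives a simple closed
  curve with image \<open>C\<close>, to which the Jordan curve theorem applies.\<close>

lemma Jordan_two_arcs:
  fixes c d :: "real \<Rightarrow> complex"
  assumes "arc c" "arc d" "pathstart c = a" "pathfinish c = b" "pathstart d = a" "pathfinish d = b"
    and "path_image c \<inter> path_image d = {a, b}"
  defines "C \<equiv> path_image c \<union> path_image d"
  shows "inside C \<noteq> {}" "open (inside C)" "connected (inside C)" "open (outside C)"
    "connected (outside C)" "frontier (inside C) = C" "compact C"
proof -
  have "simple_path (c +++ reversepath d)"
    using assms by (intro simple_path_join_loop) (auto simp: arc_reversepath)
  moreover have "path_image (c +++ reversepath d) = C"
    using assms by (simp add: path_image_join)
  ultimately show "inside C \<noteq> {}" "open (inside C)" "connected (inside C)" "open (outside C)"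
    "connected (outside C)" "frontier (inside C) = C"
    using Jordan_inside_outside[of "c +++ reversepath d"] assms by auto
  show "compact C"
    using assms by (auto simp: compact_arc_image)
qed

text \<open>The inside of a set is a union of components of its complement, so a connected set off
  \<open>S\<close> that touches the inside cannot leave it.\<close>

lemma connected_subset_inside:
  assumes "connected T" "T \<inter> S = {}" "x \<in> T" "x \<in> inside S"
  shows "T \<subseteq> inside S"
proof
  fix y assume "y \<in> T"
  then have "connected_component (- S) x y"
    using assms by (intro connected_componentI[of T]) auto
  then show "y \<in> inside S"
    using assms inside_same_component by blast
qed

text \<open>Otherwise a point \<open>x\<close> inside one of the three closed curves would be
  outside the other two, and Janiszewski's theorem would join it to a point \<open>y\<close> outside
  all of them without meeting any arc.\<close>

lemma theta_some_arc_inside: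
  assumes "theta c1 c2 c3 a b"
  shows "path_image c3 \<inter> inside (path_image c1 \<union> path_image c2) \<noteq> {} \<or>
    path_image c1 \<inter> inside (path_image c2 \<union> path_image c3) \<noteq> {} \<or>
    path_image c2 \<inter> inside (path_image c3 \<union> path_image c1) \<noteq> {}"
proof (rule ccontr)
  let ?P = "path_image c1" and ?Q = "path_image c2" and ?R = "path_image c3"
  assume "\<not> ?thesis"
  then have n: "?R \<inter> inside (?P \<union> ?Q) = {}" "?P \<inter> inside (?Q \<union> ?R) = {}"
    "?Q \<inter> inside (?R \<union> ?P) = {}" by auto
  note th = assms[unfolded theta_def]
  have ab: "a \<in> ?P" "b \<in> ?P" "a \<in> ?Q" "b \<in> ?Q" "a \<in> ?R" "b \<in> ?R"
    using th by auto
  have arcs: "arc c1" "arc c2" "arc c3"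
    and ends: "pathstart c1 = a" "pathfinish c1 = b" "pathstart c2 = a" "pathfinish c2 = b"
      "pathstart c3 = a" "pathfinish c3 = b"
    and int: "?P \<inter> ?Q = {a, b}" "?Q \<inter> ?R = {a, b}" "?R \<inter> ?P = {a, b}"
    using th by auto
  note J12 = Jordan_two_arcs[OF arcs(1,2) ends(1,2,3,4) int(1)]
    and J23 = Jordan_two_arcs[OF arcs(2,3) ends(3,4,5,6) int(2)]
    and J31 = Jordan_two_arcs[OF arcs(3,1) ends(5,6,1,2) int(3)]
  have other: "\<exists>x\<in>path_image c. x \<noteq> a \<and> x \<noteq> b" if "arc c" for c :: "real \<Rightarrow> complex"
  proof -
    have "infinite (path_image c)"
      using that by (metis arc_def finite_imageD infinite_Icc path_image_def zero_less_one)
    then show ?thesis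
      by (metis finite.emptyI finite_insert infinite_super insertCI subsetI)
  qed
  obtain x where x: "x \<in> inside (?Q \<union> ?R)"
    using J23(1) by auto
  have x1: "x \<notin> inside (?P \<union> ?Q)"
  proof
    \<comment> \<open>Neither inside meets the curve of the other, so a common point makes the two
      insides equal. Their frontiers would then agree as well, although \<open>?P\<close> has a
      point off \<open>?Q\<close> and \<open>?R\<close>.\<close>
    assume x': "x \<in> inside (?P \<union> ?Q)"
    have "inside (?P \<union> ?Q) \<subseteq> inside (?Q \<union> ?R)"
      using n inside_no_overlap[of "?P \<union> ?Q"]
      by (intro connected_subset_inside[OF J12(3) _ x' x]) blast
    moreover have "inside (?Q \<union> ?R) \<subseteq> inside (?P \<union> ?Q)"
      using n inside_no_overlap[of "?Q \<union> ?R"]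
      by (intro connected_subset_inside[OF J23(3) _ x x']) blast
    ultimately have "inside (?P \<union> ?Q) = inside (?Q \<union> ?R)"
      by (rule subset_antisym)
    then have "?P \<union> ?Q = ?Q \<union> ?R"
      using J12(6) J23(6) by metis
    moreover obtain y where "y \<in> ?P" "y \<noteq> a" "y \<noteq> b"
      using other[OF arcs(1)] by blast
    ultimately show False
      using int by blast
  qed
  have x2: "x \<notin> inside (?R \<union> ?P)"
  proof
    assume x': "x \<in> inside (?R \<union> ?P)"
    have "inside (?R \<union> ?P) \<subseteq> inside (?Q \<union> ?R)"
      using n inside_no_overlap[of "?R \<union> ?P"]
      by (intro connected_subset_inside[OF J31(3) _ x' x]) blast
    moreover have "inside (?Q \<union> ?R) \<subseteq> inside (?R \<union> ?P)"
      using n inside_no_overlap[of "?Q \<union> ?R"]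
      by (intro connected_subset_inside[OF J23(3) _ x x']) blast
    ultimately have "inside (?R \<union> ?P) = inside (?Q \<union> ?R)"
      by (rule subset_antisym)
    then have "?R \<union> ?P = ?Q \<union> ?R"
      using J31(6) J23(6) by metis
    moreover obtain y where "y \<in> ?P" "y \<noteq> a" "y \<noteq> b"
      using other[OF arcs(1)] by blast
    ultimately show False
      using int by blast
  qed
  have xn: "x \<notin> ?P" "x \<notin> ?Q" "x \<notin> ?R"
    using x n inside_no_overlap[of "?Q \<union> ?R"] by blast+
  have out: "x \<in> outside (?P \<union> ?Q)" "x \<in> outside (?R \<union> ?P)"
    using x1 x2 xn inside_Un_outside[of "?P \<union> ?Q"] inside_Un_outside[of "?R \<union> ?P"] by blast+
  have "bounded (?P \<union> ?Q \<union> ?R)"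
    using th by (auto intro: bounded_arc_image)
  then obtain y where y: "y \<in> outside (?P \<union> ?Q \<union> ?R)"
    using outside_bounded_nonempty by blast
  have yo: "y \<in> outside (?P \<union> ?Q)" "y \<in> outside (?R \<union> ?P)" "y \<in> outside (?Q \<union> ?R)"
    using y outside_mono[of "?P \<union> ?Q" "?P \<union> ?Q \<union> ?R"] outside_mono[of "?R \<union> ?P" "?P \<union> ?Q \<union> ?R"]
      outside_mono[of "?Q \<union> ?R" "?P \<union> ?Q \<union> ?R"] by auto
  have "connected_component (- (?P \<union> ?Q)) x y"
    using out yo outside_no_overlap[of "?P \<union> ?Q"]
    by (intro connected_componentI[OF J12(5)]) blast+
  moreover have "connected_component (- (?R \<union> ?P)) x y"
    using out yo outside_no_overlap[of "?R \<union> ?P"]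
    by (intro connected_componentI[OF J31(5)]) blast+
  \<comment> \<open>Janiszewski's theorem asks for a connected intersection of the two curves; here
    it is the shared arc.\<close>
  moreover have "(?P \<union> ?Q) \<inter> (?R \<union> ?P) = ?P"
    using th ab by auto
  moreover have "connected ?P"
    using th by (simp add: connected_arc_image)
  ultimately have "connected_component (- ((?P \<union> ?Q) \<union> (?R \<union> ?P))) x y"
    using J12(7) J31(7) by (intro Janiszewski[of "?P \<union> ?Q" "?R \<union> ?P"]) (simp_all add: compact_imp_closed)
  then have "connected_component (- (?Q \<union> ?R)) x y"
    by (rule connected_component_of_subset) auto
  then have "y \<in> inside (?Q \<union> ?R)"
    using x inside_same_component by blast
  with yo show False
    using inside_Int_outside by blast
qed

text \<open>The arc \<open>c3\<close> cuts the inside of the curve formed by \<open>c1\<close> and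
  \<open>c2\<close> into two halves. Near \<open>b3\<close> the set \<open>T\<close> enters one of
  them and so lies in it completely; its closure then misses the interior of the arc that bounds
  only the other half.\<close>

lemma theta_touching_aux:
  assumes "theta c1 c2 c3 a b"
    and inn: "path_image c3 \<inter> inside (path_image c1 \<union> path_image c2) \<noteq> {}"
    and T: "connected T" "T \<inter> (path_image c1 \<union> path_image c2 \<union> path_image c3) = {}"
    and b1: "b1 \<in> closure T" "b1 \<in> path_image c1 - {a, b}"
    and b2: "b2 \<in> closure T" "b2 \<in> path_image c2 - {a, b}"
    and b3: "b3 \<in> closure T" "b3 \<in> path_image c3 - {a, b}"
  shows False
proof -
  let ?P = "path_image c1" and ?Q = "path_image c2" and ?R = "path_image c3"
  note th = assms(1)[unfolded theta_def]
  have J: "open (inside (?P \<union> ?Q))" "closed (?Q \<union> ?R)" "closed (?P \<union> ?R)"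
    using th Jordan_two_arcs(2)[of c1 c2 a b] by (auto intro: closed_Un closed_arc_image)
  have sp: "inside (?P \<union> ?R) \<inter> inside (?Q \<union> ?R) = {}"
    "inside (?P \<union> ?R) \<union> inside (?Q \<union> ?R) \<union> (?R - {a,b}) = inside (?P \<union> ?Q)"
    using split_inside_simple_closed_curve[of c1 a b c2 c3] th inn arc_imp_simple_path by auto
  have "b3 \<in> inside (?P \<union> ?Q)"
    using sp b3 by auto
  moreover have "open (inside (?P \<union> ?Q))"
    by (rule J)
  ultimately obtain t where t: "t \<in> T" "t \<in> inside (?P \<union> ?Q)"
    using b3(1) open_Int_closure_eq_empty[of "inside (?P \<union> ?Q)" T] by blast
  then have "t \<in> inside (?P \<union> ?R) \<or> t \<in> inside (?Q \<union> ?R)"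
    using sp T by blast
  then show False
  proof
    assume "t \<in> inside (?P \<union> ?R)"
    then have "T \<subseteq> inside (?P \<union> ?R)"
      using t T by (intro connected_subset_inside[of _ _ t]) auto
    then have "b2 \<in> ?P \<union> ?R \<union> inside (?P \<union> ?R)"
      using b2 closure_mono closure_inside_subset[of "?P \<union> ?R"] J by blast
    then have "b2 \<in> inside (?P \<union> ?R)"
      using b2 th by blast
    then show False
      using sp b2 inside_no_overlap[of "?P \<union> ?Q"] by blast
  next
    assume "t \<in> inside (?Q \<union> ?R)"
    then have "T \<subseteq> inside (?Q \<union> ?R)"
      using t T by (intro connected_subset_inside[of _ _ t]) auto
    then have "b1 \<in> ?Q \<union> ?R \<union> inside (?Q \<union> ?R)"
      using b1 closure_mono closure_inside_subset[of "?Q \<union> ?R"] J by blast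
    then have "b1 \<in> inside (?Q \<union> ?R)"
      using b1 th by blast
    then show False
      using sp b1 inside_no_overlap[of "?P \<union> ?Q"] by blast
  qed
qed

text \<open>Some arc runs inside the curve of the other two; as the hypotheses are symmetric, a
  rotation makes that arc the third one.\<close>

lemma theta_no_touching:
  assumes "theta c1 c2 c3 a b"
    and T: "connected T" "T \<inter> (path_image c1 \<union> path_image c2 \<union> path_image c3) = {}"
    and b1: "b1 \<in> closure T" "b1 \<in> path_image c1 - {a, b}"
    and b2: "b2 \<in> closure T" "b2 \<in> path_image c2 - {a, b}"
    and b3: "b3 \<in> closure T" "b3 \<in> path_image c3 - {a, b}"
  shows False
proof -
  note th1 = assms(1)
  note th2 = theta_rotate[OF th1]
  note th3 = theta_rotate[OF th2]
  show False
    using theta_some_arc_inside[OF th1] theta_touching_aux[OF th1 _ T b1 b2 b3]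
      theta_touching_aux[OF th2 _ T(1) _ b2 b3 b1] theta_touching_aux[OF th3 _ T(1) _ b3 b1 b2] T(2)
    by (auto simp: Un_ac)
qed

section \<open>Minors of plane drawings\<close>

fun walk_edges :: "'a list \<Rightarrow> 'a set set" where
  "walk_edges (u # v # vs) = insert {u, v} (walk_edges (v # vs))"
| "walk_edges _ = {}"

text \<open>At least two vertices are required so that a path always traces an arc; a single vertex
  would have an empty \<open>walk_image\<close>.\<close>

definition graph_path :: "('a, 'b) pre_digraph \<Rightarrow> 'a \<Rightarrow> 'a list \<Rightarrow> 'a \<Rightarrow> bool" where
  "graph_path G a vs b \<longleftrightarrow> 2 \<le> length vs \<and> distinct vs \<and> set vs \<subseteq> verts G \<and>
     walk_edges vs \<subseteq> undirected_edges G \<and> hd vs = a \<and> last vs = b"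

definition walk_image :: "('a set \<Rightarrow> real \<Rightarrow> complex) \<Rightarrow> 'a list \<Rightarrow> complex set" where
  "walk_image \<gamma> vs = (\<Union>e\<in>walk_edges vs. path_image (\<gamma> e))"

lemma walk_edges_subset: "e \<in> walk_edges vs \<Longrightarrow> e \<subseteq> set vs"
  by (induction vs rule: walk_edges.induct) auto

lemma Union_walk_edges: "2 \<le> length vs \<Longrightarrow> \<Union> (walk_edges vs) = set vs"
proof (induction vs rule: walk_edges.induct)
  case (1 u v vs)
  then show ?case by (cases vs) auto
qed auto

lemma plane_drawing_edge_arc:
  assumes "plane_drawing G p \<gamma>" "{u, v} \<in> undirected_edges G"
  obtains g where "arc g" "pathstart g = p u" "pathfinish g = p v" "path_image g = path_image (\<gamma> {u, v})"
proof -
  have *: "arc (\<gamma> {u, v})" "{pathstart (\<gamma> {u, v}), pathfinish (\<gamma> {u, v})} = {p u, p v}"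
    using assms by (auto simp: plane_drawing_def)
  then consider "pathstart (\<gamma> {u, v}) = p u" "pathfinish (\<gamma> {u, v}) = p v"
    | "pathstart (\<gamma> {u, v}) = p v" "pathfinish (\<gamma> {u, v}) = p u"
    by (auto simp: doubleton_eq_iff)
  then show thesis
  proof cases
    case 1
    then show ?thesis using * that by blast
  next
    case 2
    then show ?thesis
      using * that[of "reversepath (\<gamma> {u, v})"] by (simp add: arc_reversepath)
  qed
qed

lemma plane_drawing_edges_Int:
  assumes "plane_drawing G p \<gamma>" "e \<in> undirected_edges G" "f \<in> undirected_edges G" "e \<noteq> f"
  shows "path_image (\<gamma> e) \<inter> path_image (\<gamma> f) = p ` (e \<inter> f)"
  using assms unfolding plane_drawing_def by blast

lemma plane_drawing_edge_ends:
  assumes "plane_drawing G p \<gamma>" "e \<in> undirected_edges G"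
  shows "p ` e \<subseteq> path_image (\<gamma> e)"
  using assms unfolding plane_drawing_def by blast

lemma walk_image_Int:
  assumes "plane_drawing G p \<gamma>" "walk_edges vs \<subseteq> undirected_edges G" "walk_edges ws \<subseteq> undirected_edges G"
    and "walk_edges vs \<inter> walk_edges ws = {}"
  shows "walk_image \<gamma> vs \<inter> walk_image \<gamma> ws \<subseteq> p ` (set vs \<inter> set ws)"
proof
  fix x assume "x \<in> walk_image \<gamma> vs \<inter> walk_image \<gamma> ws"
  then obtain e f where ef: "e \<in> walk_edges vs" "f \<in> walk_edges ws"
    "x \<in> path_image (\<gamma> e) \<inter> path_image (\<gamma> f)"
    by (auto simp: walk_image_def)
  moreover have "path_image (\<gamma> e) \<inter> path_image (\<gamma> f) = p ` (e \<inter> f)"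
    using assms ef by (intro plane_drawing_edges_Int) auto
  ultimately have "x \<in> p ` (e \<inter> f)"
    by simp
  then show "x \<in> p ` (set vs \<inter> set ws)"
    using walk_edges_subset[OF ef(1)] walk_edges_subset[OF ef(2)] by blast
qed

lemma vertices_in_walk_image:
  assumes "plane_drawing G p \<gamma>" "graph_path G a vs b"
  shows "p ` set vs \<subseteq> walk_image \<gamma> vs"
proof
  fix x assume "x \<in> p ` set vs"
  moreover have "\<Union> (walk_edges vs) = set vs"
    using assms(2) Union_walk_edges by (auto simp: graph_path_def)
  ultimately obtain e v where "e \<in> walk_edges vs" "v \<in> e" "x = p v"
    by blast
  moreover then have "p ` e \<subseteq> path_image (\<gamma> e)"
    using assms(2) by (intro plane_drawing_edge_ends[OF assms(1)]) (auto simp: graph_path_def)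
  ultimately show "x \<in> walk_image \<gamma> vs"
    by (auto simp: walk_image_def)
qed

text \<open>Induction along the path: the arc of the first edge meets the arc of the rest only at
  the shared vertex, because the first vertex does not recur.\<close>

lemma graph_path_arc:
  assumes "plane_drawing G p \<gamma>" "graph_path G a vs b"
  shows "\<exists>g. arc g \<and> pathstart g = p a \<and> pathfinish g = p b \<and> path_image g = walk_image \<gamma> vs"
  using assms(2)
proof (induction vs arbitrary: a rule: walk_edges.induct)
  case (1 u v vs)
  then have e: "{u, v} \<in> undirected_edges G" "a = u"
    by (auto simp: graph_path_def)
  obtain h where h: "arc h" "pathstart h = p u" "pathfinish h = p v" "path_image h = path_image (\<gamma> {u, v})"
    using plane_drawing_edge_arc[OF assms(1) e(1)] by metis
  show ?case
  proof (cases "vs = []")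
    case True
    then show ?thesis
      using h 1 by (auto simp: graph_path_def walk_image_def)
  next
    case False
    then have "graph_path G v (v # vs) b"
      using 1 by (cases vs) (auto simp: graph_path_def)
    then obtain g where g: "arc g" "pathstart g = p v" "pathfinish g = p b"
      "path_image g = walk_image \<gamma> (v # vs)"
      using 1 by blast
    have "u \<notin> set (v # vs)"
      using 1 by (auto simp: graph_path_def)
    then have "walk_edges [u, v] \<inter> walk_edges (v # vs) = {}"
      using walk_edges_subset[of "{u, v}" "v # vs"] by auto
    then have "walk_image \<gamma> [u, v] \<inter> walk_image \<gamma> (v # vs) \<subseteq> p ` (set [u, v] \<inter> set (v # vs))"
      using 1(2) by (intro walk_image_Int[OF assms(1)]) (auto simp: graph_path_def)
    then have "path_image h \<inter> path_image g \<subseteq> {pathstart g}"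
      using h g \<open>u \<notin> set (v # vs)\<close> by (auto simp: walk_image_def)
    then have "arc (h +++ g)"
      using h g by (intro arc_join) auto
    moreover have "path_image (h +++ g) = walk_image \<gamma> (u # v # vs)"
      using h g by (simp add: path_image_join walk_image_def)
    ultimately show ?thesis
      using h g e by (intro exI[of _ "h +++ g"]) auto
  qed
qed (auto simp: graph_path_def)

text \<open>By injectivity of the parametrization, the arc without its end is the image of
  \<open>{0..<1}\<close>, an interval that is connected and has 1 in its closure.\<close>

lemma arc_minus_finish:
  fixes g :: "real \<Rightarrow> 'a::t2_space"
  assumes "arc g"
  shows "connected (path_image g - {pathfinish g})"
    and "pathfinish g \<in> closure (path_image g - {pathfinish g})"
proof -
  have cont: "continuous_on {0..1} g" and inj: "inj_on g {0..1}"
    using assms by (auto simp: arc_def path_def)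
  have eq: "path_image g - {pathfinish g} = g ` {0..<1}"
  proof -
    have "g x = g 1 \<longleftrightarrow> x = 1" if "x \<in> {0..1}" for x
      using that inj by (auto simp: inj_on_eq_iff)
    then show ?thesis
      by (auto simp: path_image_def pathfinish_def image_iff less_le)
  qed
  show "connected (path_image g - {pathfinish g})"
    unfolding eq by (intro connected_continuous_image continuous_on_subset[OF cont]) auto
  have "g ` closure {0..<1} \<subseteq> closure (g ` {0..<1})"
    using cont by (intro image_closure_subset) (auto simp: closure_subset)
  then have "g ` {0..1} \<subseteq> closure (g ` {0..<1})"
    by simp
  then show "pathfinish g \<in> closure (path_image g - {pathfinish g})"
    unfolding eq by (auto simp: pathfinish_def)
qed

text \<open>
  The hypotheses describe a \<open>K\<^bsub>3,3\<^esub>\<close> minor with the branch sets \<open>{a}\<close>, \<open>{b}\<close>, the union of the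
  three paths from \<open>z\<close> without their ends, and the interiors of the three paths from \<open>a\<close> to \<open>b\<close>.
\<close>

lemma not_planar_if_K33_minor:
  assumes w: "graph_path G a w1 b" "graph_path G a w2 b" "graph_path G a w3 b"
    and int: "set w1 \<inter> set w2 = {a, b}" "set w1 \<inter> set w3 = {a, b}" "set w2 \<inter> set w3 = {a, b}"
    and dis: "walk_edges w1 \<inter> walk_edges w2 = {}" "walk_edges w1 \<inter> walk_edges w3 = {}"
      "walk_edges w2 \<inter> walk_edges w3 = {}"
    and r: "graph_path G z r1 t1" "graph_path G z r2 t2" "graph_path G z r3 t3"
    and t: "t1 \<in> set w1 - {a, b}" "t2 \<in> set w2 - {a, b}" "t3 \<in> set w3 - {a, b}"
    and rint: "set r1 \<inter> (set w1 \<union> set w2 \<union> set w3) = {t1}"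
      "set r2 \<inter> (set w1 \<union> set w2 \<union> set w3) = {t2}"
      "set r3 \<inter> (set w1 \<union> set w2 \<union> set w3) = {t3}"
  shows "\<not> planar G"
proof
  assume "planar G"
  then obtain p \<gamma> where D: "plane_drawing G p \<gamma>"
    by (auto simp: planar_def)
  have inj: "inj_on p (verts G)"
    using D by (simp add: plane_drawing_def)
  have V: "set w1 \<subseteq> verts G" "set w2 \<subseteq> verts G" "set w3 \<subseteq> verts G"
    using w by (auto simp: graph_path_def)
  obtain c1 where c1: "arc c1" "pathstart c1 = p a" "pathfinish c1 = p b"
      "path_image c1 = walk_image \<gamma> w1"
    using graph_path_arc[OF D w(1)] by blast
  obtain c2 where c2: "arc c2" "pathstart c2 = p a" "pathfinish c2 = p b"
      "path_image c2 = walk_image \<gamma> w2"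
    using graph_path_arc[OF D w(2)] by blast
  obtain c3 where c3: "arc c3" "pathstart c3 = p a" "pathfinish c3 = p b"
      "path_image c3 = walk_image \<gamma> w3"
    using graph_path_arc[OF D w(3)] by blast
  note c = c1 c2 c3
  have int': "walk_image \<gamma> w \<inter> walk_image \<gamma> w' = {p a, p b}"
    if "graph_path G a w b" "graph_path G a w' b" "set w \<inter> set w' = {a, b}"
      "walk_edges w \<inter> walk_edges w' = {}" for w w'
  proof
    show "walk_image \<gamma> w \<inter> walk_image \<gamma> w' \<subseteq> {p a, p b}"
      using walk_image_Int[OF D, of w w'] that by (simp add: graph_path_def)
    show "{p a, p b} \<subseteq> walk_image \<gamma> w \<inter> walk_image \<gamma> w'"
      using that(1,2)[THEN vertices_in_walk_image[OF D]] that(3) by blast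
  qed
  have ab: "p a \<noteq> p b"
    using arc_distinct_ends[OF c1(1)] c1(2,3) by simp
  have th: "theta c1 c2 c3 (p a) (p b)"
    using c int'[OF w(1,2) int(1) dis(1)] int'[OF w(1,3) int(2) dis(2)] int'[OF w(2,3) int(3) dis(3)] ab
    by (simp add: theta_def)
  \<comment> \<open>A leg keeps the hub \<open>p z\<close> but loses its foot \<open>p t\<close>.
    The union \<open>?T\<close> of the three legs is connected through the hub, misses the theta
    graph and has the three feet in its closure.\<close>
  let ?R = "\<lambda>r t. walk_image \<gamma> r - {p t}"
  let ?T = "?R r1 t1 \<union> ?R r2 t2 \<union> ?R r3 t3"
  have arm: "connected (?R r t)" "p t \<in> closure (?R r t)" "p z \<in> ?R r t"
    "?R r t \<inter> walk_image \<gamma> w = {}"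
    if r: "graph_path G z r t" "set r \<inter> (set w1 \<union> set w2 \<union> set w3) = {t}" and "w \<in> {w1, w2, w3}"
    for r t w
  proof -
    have arm: "graph_path G z r t" "set r \<inter> set w \<subseteq> {t}" "graph_path G a w b"
      using that w by auto
    obtain g where g: "arc g" "pathstart g = p z" "pathfinish g = p t" "path_image g = walk_image \<gamma> r"
      using graph_path_arc[OF D arm(1)] by blast
    show "connected (?R r t)" "p t \<in> closure (?R r t)"
      using arc_minus_finish[OF g(1)] by (simp_all add: g)
    show "p z \<in> ?R r t"
      using arc_distinct_ends[OF g(1)] pathstart_in_path_image[of g] by (simp add: g)
    \<comment> \<open>A common edge would have both its ends in \<open>{t}\<close>.\<close>
    have "walk_edges r \<inter> walk_edges w = {}"
    proof (rule ccontr)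
      assume "walk_edges r \<inter> walk_edges w \<noteq> {}"
      then obtain e where e: "e \<in> walk_edges r" "e \<in> walk_edges w"
        by auto
      then have "e \<subseteq> {t}"
        using arm(2) walk_edges_subset[of e r] walk_edges_subset[of e w] by blast
      moreover have "e \<in> undirected_edges G"
        using e arm(1) by (auto simp: graph_path_def)
      ultimately show False
        by (auto simp: undirected_edges_def doubleton_eq_iff)
    qed
    then have "walk_image \<gamma> r \<inter> walk_image \<gamma> w \<subseteq> p ` (set r \<inter> set w)"
      using arm by (intro walk_image_Int[OF D]) (auto simp: graph_path_def)
    then have "walk_image \<gamma> r \<inter> walk_image \<gamma> w \<subseteq> {p t}"
      using arm(2) by blast
    then show "?R r t \<inter> walk_image \<gamma> w = {}"
      by blast
  qed
  note arm1 = arm[OF r(1) rint(1)] and arm2 = arm[OF r(2) rint(2)] and arm3 = arm[OF r(3) rint(3)]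
  have con: "connected ?T"
  proof (intro connected_Un)
    show "?R r1 t1 \<inter> ?R r2 t2 \<noteq> {}" "(?R r1 t1 \<union> ?R r2 t2) \<inter> ?R r3 t3 \<noteq> {}"
      using arm1(3)[of w1] arm2(3)[of w1] arm3(3)[of w1] by blast+
  qed (use arm1(1)[of w1] arm2(1)[of w1] arm3(1)[of w1] in auto)
  have dis: "?T \<inter> (path_image c1 \<union> path_image c2 \<union> path_image c3) = {}"
    by (simp add: c Int_Un_distrib Int_Un_distrib2 arm1(4) arm2(4) arm3(4))
  have cl: "p t1 \<in> closure ?T" "p t2 \<in> closure ?T" "p t3 \<in> closure ?T"
    using arm1(2)[of w1] arm2(2)[of w1] arm3(2)[of w1] by auto
  have ver: "a \<in> verts G" "b \<in> verts G" "t1 \<in> verts G" "t2 \<in> verts G" "t3 \<in> verts G"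
    using V int t by blast+
  have pt: "p t1 \<in> path_image c1 - {p a, p b}" "p t2 \<in> path_image c2 - {p a, p b}"
    "p t3 \<in> path_image c3 - {p a, p b}"
    using t w[THEN vertices_in_walk_image[OF D]] ver unfolding c by (auto simp: inj_on_eq_iff[OF inj])
  show False
    by (rule theta_no_touching[OF th con dis cl(1) pt(1) cl(2) pt(2) cl(3) pt(3)])
qed

section \<open>Two nonplanar graphs\<close>

text \<open>The vertices \<open>a1\<close> and \<open>a2\<close> become the ends of the theta graph,
  \<open>b1\<close>, \<open>b2\<close>, \<open>b3\<close> the middles of its arcs, and
  \<open>a3\<close> the hub joined to all three.\<close>

lemma not_planar_K33:
  assumes "distinct [a1, a2, a3, b1, b2, b3]" "{a1, a2, a3, b1, b2, b3} \<subseteq> verts G"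
    and e: "\<And>a b. a \<in> {a1, a2, a3} \<Longrightarrow> b \<in> {b1, b2, b3} \<Longrightarrow> {a, b} \<in> undirected_edges G"
  shows "\<not> planar G"
proof (rule not_planar_if_K33_minor)
  have path: "graph_path G a1 [a1, b, a2] a2" "graph_path G a3 [a3, b] b" if "b \<in> {b1, b2, b3}" for b
    using that assms(1,2) e[of a1 b] e[of a2 b] e[of a3 b]
    by (auto simp: graph_path_def insert_commute)
  show "graph_path G a1 [a1, b1, a2] a2" "graph_path G a1 [a1, b2, a2] a2"
    "graph_path G a1 [a1, b3, a2] a2" "graph_path G a3 [a3, b1] b1" "graph_path G a3 [a3, b2] b2"
    "graph_path G a3 [a3, b3] b3"
    by (simp_all add: path)
qed (use assms(1) in \<open>auto simp: doubleton_eq_iff\<close>)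

lemma not_planar_Q4:
  fixes f :: "bool \<Rightarrow> bool \<Rightarrow> bool \<Rightarrow> bool \<Rightarrow> 'a"
  assumes inj: "\<And>p q r s p' q' r' s'. f p q r s = f p' q' r' s' \<longleftrightarrow> p = p' \<and> q = q' \<and> r = r' \<and> s = s'"
    and ver: "\<And>p q r s. f p q r s \<in> verts G"
    and e: "\<And>q r s. {f False q r s, f True q r s} \<in> undirected_edges G"
      "\<And>p r s. {f p False r s, f p True r s} \<in> undirected_edges G"
      "\<And>p q s. {f p q False s, f p q True s} \<in> undirected_edges G"
      "\<And>p q r. {f p q r False, f p q r True} \<in> undirected_edges G"
  shows "\<not> planar G"
proof -
  have e': "{f True q r s, f False q r s} \<in> undirected_edges G" for q r s
    using e(1)[of q r s] by (simp add: insert_commute)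
  \<comment> \<open>In the facet with first coordinate \<open>False\<close>, \<open>a\<close> and
    \<open>b\<close> are antipodal and joined by three internally disjoint paths. The hub
    \<open>z\<close> is the neighbour of \<open>a\<close> in the opposite facet; the legs stay there
    until they drop onto the second vertices of the paths.\<close>
  define a b z where "a = f False False False False" "b = f False True True True" "z = f True False False False"
  define w1 w2 w3 where
    "w1 = [a, f False True False False, f False True True False, b]"
    "w2 = [a, f False False True False, f False False True True, b]"
    "w3 = [a, f False False False True, f False True False True, b]"
  define r1 r2 r3 where
    "r1 = [z, f True True False False, f False True False False]"
    "r2 = [z, f True False True False, f False False True False]"
    "r3 = [z, f True False False True, f False False False True]"
  note defs = a_b_z_def w1_w2_w3_def r1_r2_r3_def
  show ?thesis
  proof (rule not_planar_if_K33_minor)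
    show "graph_path G a w1 b" "graph_path G a w2 b" "graph_path G a w3 b"
      by (simp_all add: graph_path_def defs inj ver e)
    show "graph_path G z r1 (f False True False False)" "graph_path G z r2 (f False False True False)"
      "graph_path G z r3 (f False False False True)"
      by (simp_all add: graph_path_def defs inj ver e e')
    show "set w1 \<inter> set w2 = {a, b}" "set w1 \<inter> set w3 = {a, b}" "set w2 \<inter> set w3 = {a, b}"
      by (simp_all add: defs inj insert_commute)
    show "walk_edges w1 \<inter> walk_edges w2 = {}" "walk_edges w1 \<inter> walk_edges w3 = {}"
      "walk_edges w2 \<inter> walk_edges w3 = {}"
      by (simp_all add: defs inj doubleton_eq_iff)
  qed (simp_all add: defs inj)
qed

section \<open>A drawing of the cube\<close>

text \<open>Two nested squares; the first coordinate selects the inner one.\<close>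

fun Q3_point :: "bool \<times> bool \<times> bool \<Rightarrow> complex" where
  "Q3_point (x, y, z) = (if x then 1 else 2) * Complex (if y then 1 else -1) (if z then 1 else -1)"

fun Q3_adj :: "bool \<times> bool \<times> bool \<Rightarrow> bool \<times> bool \<times> bool \<Rightarrow> bool" where
  "Q3_adj (x, y, z) (x', y', z') \<longleftrightarrow>
     (x \<noteq> x' \<and> y = y' \<and> z = z') \<or> (x = x' \<and> y \<noteq> y' \<and> z = z') \<or> (x = x' \<and> y = y' \<and> z \<noteq> z')"

lemma inj_Q3_point: "inj Q3_point"
  by (auto simp: inj_def complex_eq_iff split: if_splits)

lemma in_segment_complex_iff:
  "w \<in> closed_segment u v \<longleftrightarrow> (\<exists>t. 0 \<le> t \<and> t \<le> 1 \<and>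
     Re w = Re u + t * (Re v - Re u) \<and> Im w = Im u + t * (Im v - Im u))"
  by (auto simp: in_segment complex_eq_iff algebra_simps)

abbreviation (input) sq_rad :: "bool \<Rightarrow> real" where "sq_rad x \<equiv> if x then 1 else 2"
abbreviation (input) sq_sgn :: "bool \<Rightarrow> real" where "sq_sgn y \<equiv> if y then 1 else -1"

section \<open>Intersections of the edges in the drawing of the cube\<close>

text \<open>Edges in direction \<open>y\<close> are horizontal sides of a square, those in direction
  \<open>z\<close> vertical sides, and those in direction \<open>x\<close> lie on the diagonals.
  These linear descriptions, here and in the next two lemmas, decide all intersections.\<close>

lemma Q3_segment_y:
  "w \<in> closed_segment (Q3_point (x, False, z)) (Q3_point (x, True, z)) \<Longrightarrow>
    Im w = sq_rad x * sq_sgn z \<and> \<bar>Re w\<bar> \<le> sq_rad x"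
  by (cases x; cases z) (auto simp: in_segment_complex_iff)

lemma Q3_segment_z:
  "w \<in> closed_segment (Q3_point (x, y, False)) (Q3_point (x, y, True)) \<Longrightarrow>
    Re w = sq_rad x * sq_sgn y \<and> \<bar>Im w\<bar> \<le> sq_rad x"
  by (cases x; cases y) (auto simp: in_segment_complex_iff)

lemma Q3_segment_x:
  "w \<in> closed_segment (Q3_point (False, y, z)) (Q3_point (True, y, z)) \<Longrightarrow>
    Re w * sq_sgn y = Im w * sq_sgn z \<and> 1 \<le> Re w * sq_sgn y \<and> Re w * sq_sgn y \<le> 2"
  by (cases y; cases z) (auto simp: in_segment_complex_iff)

lemma Q3_adj_cases:
  assumes "Q3_adj a b"
  obtains (X) y z where "{a, b} = {(False, y, z), (True, y, z)}"
      "closed_segment (Q3_point a) (Q3_point b) = closed_segment (Q3_point (False, y, z)) (Q3_point (True, y, z))"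
    | (Y) x z where "{a, b} = {(x, False, z), (x, True, z)}"
      "closed_segment (Q3_point a) (Q3_point b) = closed_segment (Q3_point (x, False, z)) (Q3_point (x, True, z))"
    | (Z) x y where "{a, b} = {(x, y, False), (x, y, True)}"
      "closed_segment (Q3_point a) (Q3_point b) = closed_segment (Q3_point (x, y, False)) (Q3_point (x, y, True))"
proof -
  obtain x y z x' y' z' where ab: "a = (x, y, z)" "b = (x', y', z')"
    by (metis prod_cases3)
  consider "x = (\<not> x')" "y = y'" "z = z'" | "x = x'" "y = (\<not> y')" "z = z'" | "x = x'" "y = y'" "z = (\<not> z')"
    using assms ab by auto
  then show thesis
  proof cases
    case 1
    show ?thesis
      using 1 by (intro X[of y z]) (cases x; simp add: ab insert_commute closed_segment_commute)+
  next
    case 2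
    show ?thesis
      using 2 by (intro Y[of x z]) (cases y; simp add: ab insert_commute closed_segment_commute)+
  next
    case 3
    show ?thesis
      using 3 by (intro Z[of x y]) (cases z; simp add: ab insert_commute closed_segment_commute)+
  qed
qed

text \<open>Edges in different directions are compared through their linear descriptions; for edges
  in the same direction, a common point already forces the two edges to be equal.\<close>

lemma Q3_segments_Int:
  assumes "Q3_adj a b" "Q3_adj c d" "{a, b} \<noteq> {c, d}"
    and "w \<in> closed_segment (Q3_point a) (Q3_point b)" "w \<in> closed_segment (Q3_point c) (Q3_point d)"
  shows "w \<in> Q3_point ` ({a, b} \<inter> {c, d})"
proof -
  have XY: "w \<in> Q3_point ` ({(False, y, z), (True, y, z)} \<inter> {(x', False, z'), (x', True, z')})"
    if "w \<in> closed_segment (Q3_point (False, y, z)) (Q3_point (True, y, z))"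
      "w \<in> closed_segment (Q3_point (x', False, z')) (Q3_point (x', True, z'))" for y z x' z'
    using Q3_segment_x[OF that(1)] Q3_segment_y[OF that(2)]
    by (cases y; cases z; cases x'; cases z') (auto simp: complex_eq_iff)
  have XZ: "w \<in> Q3_point ` ({(False, y, z), (True, y, z)} \<inter> {(x', y', False), (x', y', True)})"
    if "w \<in> closed_segment (Q3_point (False, y, z)) (Q3_point (True, y, z))"
      "w \<in> closed_segment (Q3_point (x', y', False)) (Q3_point (x', y', True))" for y z x' y'
    using Q3_segment_x[OF that(1)] Q3_segment_z[OF that(2)]
    by (cases y; cases z; cases x'; cases y') (auto simp: complex_eq_iff)
  have YZ: "w \<in> Q3_point ` ({(x, False, z), (x, True, z)} \<inter> {(x', y', False), (x', y', True)})"
    if "w \<in> closed_segment (Q3_point (x, False, z)) (Q3_point (x, True, z))"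
      "w \<in> closed_segment (Q3_point (x', y', False)) (Q3_point (x', y', True))" for x z x' y'
    using Q3_segment_y[OF that(1)] Q3_segment_z[OF that(2)]
    by (cases x; cases z; cases x'; cases y') (auto simp: complex_eq_iff)
  have XX: "y = y' \<and> z = z'"
    if "w \<in> closed_segment (Q3_point (False, y, z)) (Q3_point (True, y, z))"
      "w \<in> closed_segment (Q3_point (False, y', z')) (Q3_point (True, y', z'))" for y z y' z'
    using Q3_segment_x[OF that(1)] Q3_segment_x[OF that(2)]
    by (cases y; cases z; cases y'; cases z') auto
  have YY: "x = x' \<and> z = z'"
    if "w \<in> closed_segment (Q3_point (x, False, z)) (Q3_point (x, True, z))"
      "w \<in> closed_segment (Q3_point (x', False, z')) (Q3_point (x', True, z'))" for x z x' z'
    using Q3_segment_y[OF that(1)] Q3_segment_y[OF that(2)]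
    by (cases x; cases z; cases x'; cases z') auto
  have ZZ: "x = x' \<and> y = y'"
    if "w \<in> closed_segment (Q3_point (x, y, False)) (Q3_point (x, y, True))"
      "w \<in> closed_segment (Q3_point (x', y', False)) (Q3_point (x', y', True))" for x y x' y'
    using Q3_segment_z[OF that(1)] Q3_segment_z[OF that(2)]
    by (cases x; cases y; cases x'; cases y') auto
  show ?thesis
    using assms(1)
  proof (cases rule: Q3_adj_cases)
    case ab: (X y z)
    show ?thesis
      using assms(2)
    proof (cases rule: Q3_adj_cases)
      case (X y' z')
      show ?thesis
        using XX[OF assms(4)[unfolded ab(2)] assms(5)[unfolded X(2)]] assms(3) unfolding ab(1) X(1) by blast
    next
      case (Y x' z')
      show ?thesis
        unfolding ab(1) Y(1) by (rule XY[OF assms(4)[unfolded ab(2)] assms(5)[unfolded Y(2)]])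
    next
      case (Z x' y')
      show ?thesis
        unfolding ab(1) Z(1) by (rule XZ[OF assms(4)[unfolded ab(2)] assms(5)[unfolded Z(2)]])
    qed
  next
    case ab: (Y x z)
    show ?thesis
      using assms(2)
    proof (cases rule: Q3_adj_cases)
      case (X y' z')
      show ?thesis
        unfolding ab(1) X(1) using XY[OF assms(5)[unfolded X(2)] assms(4)[unfolded ab(2)]]
        by (simp only: Int_commute)
    next
      case (Y x' z')
      show ?thesis
        using YY[OF assms(4)[unfolded ab(2)] assms(5)[unfolded Y(2)]] assms(3) unfolding ab(1) Y(1) by blast
    next
      case (Z x' y')
      show ?thesis
        unfolding ab(1) Z(1) by (rule YZ[OF assms(4)[unfolded ab(2)] assms(5)[unfolded Z(2)]])
    qed
  next
    case ab: (Z x y)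
    show ?thesis
      using assms(2)
    proof (cases rule: Q3_adj_cases)
      case (X y' z')
      show ?thesis
        unfolding ab(1) X(1) using XZ[OF assms(5)[unfolded X(2)] assms(4)[unfolded ab(2)]]
        by (simp only: Int_commute)
    next
      case (Y x' z')
      show ?thesis
        unfolding ab(1) Y(1) using YZ[OF assms(5)[unfolded Y(2)] assms(4)[unfolded ab(2)]]
        by (simp only: Int_commute)
    next
      case (Z x' y')
      show ?thesis
        using ZZ[OF assms(4)[unfolded ab(2)] assms(5)[unfolded Z(2)]] assms(3) unfolding ab(1) Z(1) by blast
    qed
  qed
qed

lemma Q3_vertex_in_segment:
  assumes "Q3_adj a b" "Q3_point c \<in> closed_segment (Q3_point a) (Q3_point b)"
  shows "c \<in> {a, b}"
proof -
  obtain x' y' z' where c: "c = (x', y', z')"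
    by (metis prod_cases3)
  show ?thesis
    using assms(1)
  proof (cases rule: Q3_adj_cases)
    case (X y z)
    with assms c Q3_segment_x[of "Q3_point c" y z] show ?thesis
      by (auto split: if_splits)
  next
    case (Y x z)
    with assms c Q3_segment_y[of "Q3_point c" x z] show ?thesis
      by (auto split: if_splits)
  next
    case (Z x y)
    with assms c Q3_segment_z[of "Q3_point c" x y] show ?thesis
      by (auto split: if_splits)
  qed
qed

lemma planar_if_straight_line_drawing:
  fixes P :: "'a \<Rightarrow> complex"
  assumes inj: "inj_on P (verts G)"
    and ver: "\<And>e. e \<in> undirected_edges G \<Longrightarrow> e \<subseteq> verts G"
    and vert: "\<And>u v w. {u, v} \<in> undirected_edges G \<Longrightarrow> w \<in> verts G \<Longrightarrow>
      P w \<in> closed_segment (P u) (P v) \<Longrightarrow> w \<in> {u, v}"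
    and int: "\<And>u v u' v'. {u, v} \<in> undirected_edges G \<Longrightarrow> {u', v'} \<in> undirected_edges G \<Longrightarrow>
      {u, v} \<noteq> {u', v'} \<Longrightarrow>
      closed_segment (P u) (P v) \<inter> closed_segment (P u') (P v') \<subseteq> P ` ({u, v} \<inter> {u', v'})"
  shows "planar G"
proof -
  \<comment> \<open>An edge is a set without orientation, so one of its two traversals has to be
    chosen.\<close>
  define seg where "seg e g \<longleftrightarrow> (\<exists>u v. e = {u, v} \<and> g = linepath (P u) (P v))" for e g
  define \<gamma> where "\<gamma> e = (SOME g. seg e g)" for e
  have edge: "\<exists>u v. e = {u, v} \<and> \<gamma> e = linepath (P u) (P v) \<and> u \<in> verts G \<and> v \<in> verts G \<and> u \<noteq> v"
    if e: "e \<in> undirected_edges G" for e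
  proof -
    obtain x y where "e = {x, y}" "x \<noteq> y"
      using e by (auto simp: undirected_edges_def)
    then have "seg e (linepath (P x) (P y))"
      by (auto simp: seg_def)
    then have "seg e (\<gamma> e)"
      unfolding \<gamma>_def by (rule someI[of "seg e"])
    then obtain u v where uv: "e = {u, v}" "\<gamma> e = linepath (P u) (P v)"
      unfolding seg_def by blast
    moreover have "u \<noteq> v"
      using \<open>e = {x, y}\<close> \<open>x \<noteq> y\<close> uv(1) by auto
    ultimately show ?thesis
      using ver[OF e] by blast
  qed
  have "plane_drawing G P \<gamma>"
    unfolding plane_drawing_def
  proof (intro conjI ballI impI inj)
    fix e assume ee: "e \<in> undirected_edges G"
    then obtain u v where e: "e = {u, v}" "\<gamma> e = linepath (P u) (P v)"
      "u \<in> verts G" "v \<in> verts G" "u \<noteq> v"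
      using edge[OF ee] by blast
    show "arc (\<gamma> e)"
      using e inj by (simp add: inj_on_eq_iff)
    show "{pathstart (\<gamma> e), pathfinish (\<gamma> e)} = P ` e"
      unfolding e(2) by (simp add: e(1))
    have "closed_segment (P u) (P v) \<inter> P ` verts G = P ` {u, v}"
      using vert[of u v] ee e by auto
    then show "path_image (\<gamma> e) \<inter> P ` verts G = P ` e"
      unfolding e(2) by (simp only: e(1) path_image_linepath)
  next
    fix e e' assume ee: "e \<in> undirected_edges G" "e' \<in> undirected_edges G" "e \<noteq> e'"
    obtain u v where e: "e = {u, v}" "\<gamma> e = linepath (P u) (P v)"
      using edge[OF ee(1)] by blast
    obtain u' v' where e': "e' = {u', v'}" "\<gamma> e' = linepath (P u') (P v')"
      using edge[OF ee(2)] by blast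
    have "P ` ({u, v} \<inter> {u', v'}) \<subseteq> closed_segment (P u) (P v) \<inter> closed_segment (P u') (P v')"
      by auto
    then have "closed_segment (P u) (P v) \<inter> closed_segment (P u') (P v') = P ` ({u, v} \<inter> {u', v'})"
      using int[of u v u' v'] ee[unfolded e(1) e'(1)] by (intro subset_antisym)
    then show "path_image (\<gamma> e) \<inter> path_image (\<gamma> e') = P ` (e \<inter> e')"
      unfolding e(2) e'(2) by (simp only: e(1) e'(1) path_image_linepath)
  qed
  then show ?thesis
    by (auto simp: planar_def)
qed

lemma planar_if_subgraph_Q3:
  assumes inj: "inj_on f (verts G)"
    and adj: "\<And>u v. {u, v} \<in> undirected_edges G \<Longrightarrow> Q3_adj (f u) (f v)"
    and ver: "\<And>e. e \<in> undirected_edges G \<Longrightarrow> e \<subseteq> verts G"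
  shows "planar G"
proof (rule planar_if_straight_line_drawing[where P = "Q3_point \<circ> f", OF _ ver])
  show "inj_on (Q3_point \<circ> f) (verts G)"
    using inj inj_Q3_point by (metis comp_inj_on inj_on_subset subset_UNIV)
next
  fix u v w
  assume e: "{u, v} \<in> undirected_edges G" and w: "w \<in> verts G"
    "(Q3_point \<circ> f) w \<in> closed_segment ((Q3_point \<circ> f) u) ((Q3_point \<circ> f) v)"
  have "f w \<in> f ` {u, v}"
    using Q3_vertex_in_segment[OF adj[OF e], of "f w"] w(2) by simp
  then show "w \<in> {u, v}"
    using inj_on_image_mem_iff[OF inj w(1) ver[OF e]] by blast
next
  fix u v u' v'
  assume e: "{u, v} \<in> undirected_edges G" "{u', v'} \<in> undirected_edges G" "{u, v} \<noteq> {u', v'}"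
  have "f ` {u, v} \<noteq> f ` {u', v'}"
    using inj_on_image_eq_iff[OF inj ver[OF e(1)] ver[OF e(2)]] e(3) by blast
  then have neq: "{f u, f v} \<noteq> {f u', f v'}"
    by simp
  have eq: "{f u, f v} \<inter> {f u', f v'} = f ` ({u, v} \<inter> {u', v'})"
    using inj_on_image_Int[OF inj ver[OF e(1)] ver[OF e(2)]] by simp
  have "closed_segment (Q3_point (f u)) (Q3_point (f v)) \<inter> closed_segment (Q3_point (f u')) (Q3_point (f v'))
    \<subseteq> Q3_point ` f ` ({u, v} \<inter> {u', v'})"
    unfolding eq[symmetric] using Q3_segments_Int[OF adj[OF e(1)] adj[OF e(2)] neq] by blast
  then show "closed_segment ((Q3_point \<circ> f) u) ((Q3_point \<circ> f) v) \<inter>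
      closed_segment ((Q3_point \<circ> f) u') ((Q3_point \<circ> f) v') \<subseteq> (Q3_point \<circ> f) ` ({u, v} \<inter> {u', v'})"
    by (simp only: image_comp comp_apply)
qed

section \<open>Words and Bruhat order\<close>

abbreviation adj_transp :: "nat \<Rightarrow> nat \<Rightarrow> nat" where
  "adj_transp i \<equiv> Transposition.transpose i (Suc i)"

text \<open>The product that occurs in \<open>perm_length\<close>. The last letter acts first, and
  words may be unreduced.\<close>

definition wprod :: "nat list \<Rightarrow> nat \<Rightarrow> nat" where
  "wprod w = foldr (\<circ>) (map adj_transp w) id"

lemma wprod_Nil [simp]: "wprod [] = id"
  by (simp add: wprod_def)

lemma wprod_Cons [simp]: "wprod (i # w) = adj_transp i \<circ> wprod w"
  by (simp add: wprod_def)

lemma wprod_append: "wprod (v @ w) = wprod v \<circ> wprod w"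
  by (induction v) (auto simp: comp_assoc)

lemma wprod_permutes: "set w \<subseteq> {1..<n} \<Longrightarrow> wprod w permutes {1..n}"
  by (induction w) (auto intro!: permutes_compose permutes_swap_id simp: permutes_id)

lemma bij_wprod: "bij (wprod w)"
proof (induction w)
  case (Cons i w)
  then show ?case
    unfolding wprod_Cons by (intro bij_comp) auto
qed (simp flip: id_def)

text \<open>Conjugating \<open>(i j)\<close> by the adjacent transposition at \<open>j\<close> gives
  \<open>(i j+1)\<close>.\<close>

lemma transpose_as_wprod:
  assumes "1 \<le> i" "i < j" "j \<le> n"
  shows "\<exists>w. set w \<subseteq> {1..<n} \<and> wprod w = Transposition.transpose i j"
  using assms(2,3)
proof (induction j)
  case 0
  then show ?case by simp
next
  case (Suc j)
  show ?case
  proof (cases "i = j")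
    case True
    then show ?thesis
      using assms(1) Suc.prems by (intro exI[of _ "[i]"]) auto
  next
    case False
    then obtain w where "set w \<subseteq> {1..<n}" "wprod w = Transposition.transpose i j"
      using Suc by auto
    moreover have "adj_transp j \<circ> Transposition.transpose i j \<circ> adj_transp j = Transposition.transpose i (Suc j)"
      using Suc.prems False by (auto simp: fun_eq_iff Transposition.transpose_def)
    ultimately show ?thesis
      using Suc.prems assms(1) by (intro exI[of _ "j # w @ [j]"]) (auto simp: wprod_append simp flip: comp_assoc)
  qed
qed

text \<open>The adjacent transpositions generate all permutations, so the \<open>LEAST\<close> in
  \<open>perm_length\<close> is attained.\<close>

lemma permutation_as_wprod:
  assumes "\<sigma> permutes {1..n}"
  shows "\<exists>w. set w \<subseteq> {1..<n} \<and> wprod w = \<sigma>"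
proof -
  have "finite {1..n}"
    by simp
  with assms show ?thesis
  proof (induction rule: permutes_induct)
    case id
    show ?case by (intro exI[of _ "[]"]) auto
  next
    case (swap a b p)
    then obtain v where v: "set v \<subseteq> {1..<n}" "wprod v = p"
      by blast
    have "\<exists>w. set w \<subseteq> {1..<n} \<and> wprod w = Transposition.transpose a b"
    proof (cases "a < b")
      case True
      then show ?thesis
        using swap(1,2) by (intro transpose_as_wprod) auto
    next
      case False
      then have "\<exists>w. set w \<subseteq> {1..<n} \<and> wprod w = Transposition.transpose b a"
        using swap(1,2,3) by (intro transpose_as_wprod) auto
      then show ?thesis
        by (simp add: transpose_commute)
    qed
    then obtain w where "set w \<subseteq> {1..<n}" "wprod w = Transposition.transpose a b"
      by blast
    with v show ?case
      by (intro exI[of _ "w @ v"]) (auto simp: wprod_append)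
  qed
qed

lemma perm_length_wprod_le: "set w \<subseteq> {1..<n} \<Longrightarrow> perm_length n (wprod w) \<le> length w"
  unfolding perm_length_def by (rule Least_le) (auto simp: wprod_def)

lemma reduced_word_exists:
  assumes "\<sigma> permutes {1..n}"
  obtains w where "set w \<subseteq> {1..<n}" "wprod w = \<sigma>" "length w = perm_length n \<sigma>"
proof -
  obtain v where "set v \<subseteq> {1..<n}" "wprod v = \<sigma>"
    using permutation_as_wprod[OF assms] by blast
  then have "\<exists>k. \<exists>is. length is = k \<and> set is \<subseteq> {1..<n} \<and> \<sigma> = foldr (\<circ>) (map adj_transp is) id"
    by (auto simp: wprod_def)
  from LeastI_ex[OF this] obtain w where "length w = perm_length n \<sigma>" "set w \<subseteq> {1..<n}" "wprod w = \<sigma>"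
    unfolding perm_length_def wprod_def by blast
  then show thesis
    by (intro that)
qed

section \<open>The exchange property and the steps of Bruhat order\<close>

lemma transpose_conj:
  assumes "bij f"
  shows "Transposition.transpose (f a) (f b) \<circ> f = f \<circ> Transposition.transpose a b"
  using assms by (auto simp: fun_eq_iff Transposition.transpose_def bij_def inj_eq)

text \<open>If the word without its first letter \<open>i\<close> already inverts the pair, the
  deletion happens there. Otherwise \<open>i\<close> creates the inversion, so the rest sends
  \<open>p\<close> and \<open>q\<close> to \<open>i\<close> and \<open>Suc i\<close>, and by
  conjugation the transposition on the right cancels exactly this letter.\<close>

lemma strong_exchange:
  assumes "p < q" "wprod w q < wprod w p"
  shows "\<exists>u x v. w = u @ x # v \<and> wprod w \<circ> Transposition.transpose p q = wprod (u @ v)"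
  using assms
proof (induction w)
  case Nil
  then show ?case by simp
next
  case (Cons i w)
  show ?case
  proof (cases "wprod w q < wprod w p")
    case True
    then obtain u x v where "w = u @ x # v" "wprod w \<circ> Transposition.transpose p q = wprod (u @ v)"
      using Cons by blast
    then show ?thesis
      by (intro exI[of _ "i # u"] exI[of _ x] exI[of _ v]) (simp only: append_Cons wprod_Cons comp_assoc simp_thms)
  next
    case False
    moreover have "wprod w p \<noteq> wprod w q"
      using Cons.prems(1) bij_wprod[of w] by (auto simp: bij_def inj_eq)
    ultimately have "wprod w p = i" "wprod w q = Suc i"
      using Cons.prems(2) by (auto simp: Transposition.transpose_def split: if_splits)
    then have "adj_transp i \<circ> wprod w = wprod w \<circ> Transposition.transpose p q"
      using transpose_conj[OF bij_wprod, of w p q] by simp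
    then have "wprod (i # w) \<circ> Transposition.transpose p q = wprod w"
      by (simp add: comp_assoc)
    then show ?thesis
      by (intro exI[of _ "[]"] exI[of _ i] exI[of _ w]) (simp only: append_Nil simp_thms)
  qed
qed

lemma perm_length_transpose_less:
  assumes "\<sigma> permutes {1..n}" "p < q" "\<sigma> q < \<sigma> p"
  shows "perm_length n (\<sigma> \<circ> Transposition.transpose p q) < perm_length n \<sigma>"
proof -
  obtain w where w: "set w \<subseteq> {1..<n}" "wprod w = \<sigma>" "length w = perm_length n \<sigma>"
    using reduced_word_exists[OF assms(1)] .
  obtain u x v where "w = u @ x # v" "\<sigma> \<circ> Transposition.transpose p q = wprod (u @ v)"
    using strong_exchange[of p q w] assms w by auto
  then show ?thesis
    using perm_length_wprod_le[of "u @ v" n] w by auto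
qed

text \<open>The comparison of lengths turns into an inversion at the exchanged positions: exchanging
  an inversion shortens, and exchanging a non-inversion undoes such an exchange.\<close>

lemma bruhat_step_iff:
  "bruhat_step n \<tau> \<sigma> \<longleftrightarrow> \<sigma> permutes {1..n} \<and>
     (\<exists>p\<in>{1..n}. \<exists>q\<in>{1..n}. p < q \<and> \<sigma> q < \<sigma> p \<and> \<tau> = \<sigma> \<circ> Transposition.transpose p q)"
  (is "?L \<longleftrightarrow> ?R")
proof
  assume L: ?L
  then obtain p q where pq: "p \<in> {1..n}" "q \<in> {1..n}" "p \<noteq> q" "\<tau> = \<sigma> \<circ> Transposition.transpose p q"
    by (auto simp: bruhat_step_def)
  then obtain p q where pq: "p \<in> {1..n}" "q \<in> {1..n}" "p < q" "\<tau> = \<sigma> \<circ> Transposition.transpose p q"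
    by (metis linorder_neqE_nat transpose_commute)
  have "\<sigma> q < \<sigma> p"
  proof (rule ccontr)
    assume "\<not> \<sigma> q < \<sigma> p"
    moreover have "\<sigma> p \<noteq> \<sigma> q"
      using L pq by (metis bruhat_step_def nat_neq_iff permutes_inj injD)
    ultimately have "\<tau> q < \<tau> p"
      using pq by auto
    then have "perm_length n (\<tau> \<circ> Transposition.transpose p q) < perm_length n \<tau>"
      using L pq by (intro perm_length_transpose_less) (auto simp: bruhat_step_def)
    moreover have "\<tau> \<circ> Transposition.transpose p q = \<sigma>"
      using pq by (simp add: comp_assoc)
    ultimately show False
      using L by (simp add: bruhat_step_def)
  qed
  then show ?R
    using L pq unfolding bruhat_step_def by blast
next
  assume ?R
  then obtain p q where pq: "\<sigma> permutes {1..n}" "p \<in> {1..n}" "q \<in> {1..n}" "p < q" "\<sigma> q < \<sigma> p"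
    "\<tau> = \<sigma> \<circ> Transposition.transpose p q"
    by blast
  have "\<tau> permutes {1..n}"
    unfolding pq(6) by (rule permutes_compose[OF permutes_swap_id[OF pq(2,3)] pq(1)])
  moreover have "perm_length n \<tau> < perm_length n \<sigma>" "p \<noteq> q"
    unfolding pq(6) using pq(4) perm_length_transpose_less[OF pq(1,4,5)] by auto
  ultimately show ?L
    using pq unfolding bruhat_step_def by blast
qed

lemma bruhat_stepI:
  assumes "\<sigma> permutes {1..n}" "1 \<le> p" "p < q" "q \<le> n" "\<sigma> q < \<sigma> p"
  shows "bruhat_step n (\<sigma> \<circ> Transposition.transpose p q) \<sigma>"
proof -
  have "p \<in> {1..n}" "q \<in> {1..n}"
    using assms by auto
  then show ?thesis
    unfolding bruhat_step_iff using assms by blast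
qed

section \<open>Vertices and edges of the graph below a permutation\<close>

lemma verts_bruhat_graph_below:
  "verts (bruhat_graph_below n \<sigma>) = {\<tau>. \<tau> permutes {1..n} \<and> bruhat_le n \<tau> \<sigma>}"
  by (simp add: bruhat_graph_below_def bruhat_graph_def)

lemma undirected_edges_bruhat_graph_below:
  "undirected_edges (bruhat_graph_below n \<sigma>) =
    {{\<tau>, \<rho>} | \<tau> \<rho>. \<tau> \<in> verts (bruhat_graph_below n \<sigma>) \<and> \<rho> \<in> verts (bruhat_graph_below n \<sigma>) \<and> bruhat_step n \<tau> \<rho>}"
proof -
  let ?V = "verts (bruhat_graph_below n \<sigma>)"
  have ends: "(\<tau>, \<rho>) \<in> arcs_ends (bruhat_graph_below n \<sigma>) \<longleftrightarrow> \<tau> \<in> ?V \<and> \<rho> \<in> ?V \<and> bruhat_step n \<tau> \<rho>" for \<tau> \<rho>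
    unfolding verts_bruhat_graph_below arcs_ends_def arc_to_ends_def bruhat_graph_below_def bruhat_graph_def
      induce_subgraph_def by (simp add: image_iff) blast
  have irrefl: "bruhat_step n \<tau> \<rho> \<and> \<tau> \<noteq> \<rho> \<longleftrightarrow> bruhat_step n \<tau> \<rho>" for \<tau> \<rho>
    by (auto simp: bruhat_step_def)
  show ?thesis
    unfolding undirected_edges_def ends by (simp only: irrefl conj_assoc)
qed

text \<open>Edges can be found without knowing which end is longer: one of \<open>\<rho>\<close> and
  \<open>\<tau>\<close> has an inversion at the two positions.\<close>

lemma bruhat_graph_below_edgeI:
  assumes "\<tau> \<in> verts (bruhat_graph_below n \<sigma>)" "\<rho> \<in> verts (bruhat_graph_below n \<sigma>)"
    and "\<tau> = \<rho> \<circ> Transposition.transpose p q" "p \<in> {1..n}" "q \<in> {1..n}" "p \<noteq> q"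
  shows "{\<tau>, \<rho>} \<in> undirected_edges (bruhat_graph_below n \<sigma>)"
proof -
  obtain p q where pq: "\<tau> = \<rho> \<circ> Transposition.transpose p q" "p \<in> {1..n}" "q \<in> {1..n}" "p < q"
    using assms by (metis linorder_neqE_nat transpose_commute)
  have perm: "\<tau> permutes {1..n}" "\<rho> permutes {1..n}"
    using assms by (auto simp: verts_bruhat_graph_below)
  have "\<rho> p \<noteq> \<rho> q"
    using perm(2) pq(4) by (metis nat_neq_iff permutes_inj injD)
  then consider "\<rho> q < \<rho> p" | "\<rho> p < \<rho> q"
    by linarith
  then have "bruhat_step n \<tau> \<rho> \<or> bruhat_step n \<rho> \<tau>"
  proof cases
    case 1
    then show ?thesis
      unfolding pq(1) using pq(2-4) perm by (intro disjI1 bruhat_stepI) auto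
  next
    case 2
    have eq: "\<rho> = \<tau> \<circ> Transposition.transpose p q" and less: "\<tau> q < \<tau> p"
      using 2 pq by (auto simp: comp_assoc)
    have "bruhat_step n (\<tau> \<circ> Transposition.transpose p q) \<tau>"
      using pq(2-4) perm less by (intro bruhat_stepI) auto
    then show ?thesis
      unfolding eq[symmetric] by simp
  qed
  then show ?thesis
    using assms(1,2) by (auto simp: undirected_edges_bruhat_graph_below insert_commute)
qed

lemma bruhat_le_step: "bruhat_step n \<rho> \<tau> \<Longrightarrow> bruhat_le n \<tau> \<sigma> \<Longrightarrow> bruhat_le n \<rho> \<sigma>"
  unfolding bruhat_le_def by (rule converse_rtranclp_into_rtranclp)

lemma bruhat_step_in_verts:
  assumes "bruhat_step n \<rho> \<tau>" "\<tau> \<in> verts (bruhat_graph_below n \<sigma>)"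
  shows "\<rho> \<in> verts (bruhat_graph_below n \<sigma>)"
proof -
  have "\<rho> permutes {1..n}"
    using assms(1) unfolding bruhat_step_def by blast
  moreover have "bruhat_le n \<rho> \<sigma>"
    using assms bruhat_le_step unfolding verts_bruhat_graph_below by blast
  ultimately show ?thesis
    unfolding verts_bruhat_graph_below by blast
qed

lemma not_planar_if_321_below:
  assumes \<tau>: "\<tau> permutes {1..n}" "bruhat_le n \<tau> \<sigma>"
    and ijk: "1 \<le> i" "i < j" "j < k" "k \<le> n" "\<tau> k < \<tau> j" "\<tau> j < \<tau> i"
  shows "\<not> planar (bruhat_graph_below n \<sigma>)"
proof -
  let ?t = Transposition.transpose
  let ?V = "verts (bruhat_graph_below n \<sigma>)"
  have ver: "\<rho> \<circ> ?t p q \<in> ?V" if "\<rho> \<in> ?V" "p < q" "1 \<le> p" "q \<le> n" "\<rho> q < \<rho> p" for \<rho> p q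
  proof -
    have "bruhat_step n (\<rho> \<circ> ?t p q) \<rho>"
      using that by (intro bruhat_stepI) (auto simp: verts_bruhat_graph_below)
    then show ?thesis
      using that(1) by (rule bruhat_step_in_verts)
  qed
  have v0: "\<tau> \<in> ?V"
    using \<tau> by (simp add: verts_bruhat_graph_below)
  then have v: "\<tau> \<in> ?V" "\<tau> \<circ> ?t i j \<in> ?V" "\<tau> \<circ> ?t j k \<in> ?V" "\<tau> \<circ> ?t i k \<in> ?V"
    using ver[of \<tau> i j] ver[of \<tau> j k] ver[of \<tau> i k] ijk \<tau> v0 by auto
  \<comment> \<open>Two descents reach each of the 3-cycles, which completes the six
    rearrangements.\<close>
  have v': "\<tau> \<circ> ?t i j \<circ> ?t j k \<in> ?V" "\<tau> \<circ> ?t j k \<circ> ?t i j \<in> ?V"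
    using ver[OF v(2), of j k] ver[OF v(3), of i j] ijk by auto
  have inj: "\<tau> a = \<tau> b \<longleftrightarrow> a = b" for a b
    using \<tau>(1) by (metis permutes_inj injD)
  \<comment> \<open>Each 3-cycle of the positions is a product of two transpositions in three ways,
    one for each left factor; this gives its edges to the three odd vertices.\<close>
  have tr: "?t i j \<circ> ?t j k = ?t j k \<circ> ?t i k" "?t i j \<circ> ?t j k = ?t i k \<circ> ?t i j"
    "?t j k \<circ> ?t i j = ?t i j \<circ> ?t i k" "?t j k \<circ> ?t i j = ?t i k \<circ> ?t j k"
    using ijk by (auto simp: fun_eq_iff Transposition.transpose_def)
  have eq: "\<tau> = \<tau> \<circ> ?t i j \<circ> ?t i j" "\<tau> = \<tau> \<circ> ?t j k \<circ> ?t j k" "\<tau> = \<tau> \<circ> ?t i k \<circ> ?t i k"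
    "\<tau> \<circ> ?t i j \<circ> ?t j k = \<tau> \<circ> ?t j k \<circ> ?t i k" "\<tau> \<circ> ?t i j \<circ> ?t j k = \<tau> \<circ> ?t i k \<circ> ?t i j"
    "\<tau> \<circ> ?t j k \<circ> ?t i j = \<tau> \<circ> ?t i j \<circ> ?t i k" "\<tau> \<circ> ?t j k \<circ> ?t i j = \<tau> \<circ> ?t i k \<circ> ?t j k"
    using tr by (simp_all add: comp_assoc)
  have mem: "i \<in> {1..n}" "j \<in> {1..n}" "k \<in> {1..n}" and neq: "i \<noteq> j" "j \<noteq> k" "i \<noteq> k"
    using ijk by auto
  note E = bruhat_graph_below_edgeI
  have e: "{\<tau>, \<tau> \<circ> ?t i j} \<in> undirected_edges (bruhat_graph_below n \<sigma>)"
    "{\<tau>, \<tau> \<circ> ?t j k} \<in> undirected_edges (bruhat_graph_below n \<sigma>)"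
    "{\<tau>, \<tau> \<circ> ?t i k} \<in> undirected_edges (bruhat_graph_below n \<sigma>)"
    "{\<tau> \<circ> ?t i j \<circ> ?t j k, \<tau> \<circ> ?t i j} \<in> undirected_edges (bruhat_graph_below n \<sigma>)"
    "{\<tau> \<circ> ?t i j \<circ> ?t j k, \<tau> \<circ> ?t j k} \<in> undirected_edges (bruhat_graph_below n \<sigma>)"
    "{\<tau> \<circ> ?t i j \<circ> ?t j k, \<tau> \<circ> ?t i k} \<in> undirected_edges (bruhat_graph_below n \<sigma>)"
    "{\<tau> \<circ> ?t j k \<circ> ?t i j, \<tau> \<circ> ?t i j} \<in> undirected_edges (bruhat_graph_below n \<sigma>)"
    "{\<tau> \<circ> ?t j k \<circ> ?t i j, \<tau> \<circ> ?t j k} \<in> undirected_edges (bruhat_graph_below n \<sigma>)"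
    "{\<tau> \<circ> ?t j k \<circ> ?t i j, \<tau> \<circ> ?t i k} \<in> undirected_edges (bruhat_graph_below n \<sigma>)"
    by (fact E[OF v(1,2) eq(1) mem(1,2) neq(1)] E[OF v(1,3) eq(2) mem(2,3) neq(2)]
        E[OF v(1,4) eq(3) mem(1,3) neq(3)]
        E[OF v'(1) v(2) refl mem(2,3) neq(2)] E[OF v'(1) v(3) eq(4) mem(1,3) neq(3)]
        E[OF v'(1) v(4) eq(5) mem(1,2) neq(1)]
        E[OF v'(2) v(2) eq(6) mem(1,3) neq(3)] E[OF v'(2) v(3) refl mem(1,2) neq(1)]
        E[OF v'(2) v(4) eq(7) mem(2,3) neq(2)])+
  show ?thesis
  proof (rule not_planar_K33)
    show "distinct [\<tau>, \<tau> \<circ> ?t i j \<circ> ?t j k, \<tau> \<circ> ?t j k \<circ> ?t i j, \<tau> \<circ> ?t i j, \<tau> \<circ> ?t j k, \<tau> \<circ> ?t i k]"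
    proof -
      \<comment> \<open>The values at \<open>i\<close> and \<open>j\<close> already separate the six
        permutations.\<close>
      have "distinct (map (\<lambda>\<rho>. (\<rho> i, \<rho> j)) [\<tau>, \<tau> \<circ> ?t i j \<circ> ?t j k, \<tau> \<circ> ?t j k \<circ> ?t i j,
          \<tau> \<circ> ?t i j, \<tau> \<circ> ?t j k, \<tau> \<circ> ?t i k])"
        using ijk by (simp add: Transposition.transpose_def)
      then show ?thesis
        using distinct_map by blast
    qed
  qed (use e v v' in auto)
qed

section \<open>Products of distinct adjacent transpositions\<close>

text \<open>Every adjacent transposition other than the one at \<open>i\<close> maps
  \<open>{..i}\<close> to itself.\<close>

lemma wprod_image_atMost:
  assumes "i \<notin> set w"
  shows "wprod w ` {..i} = {..i}"
  using assms
proof (induction w)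
  case (Cons j w)
  have "adj_transp j ` {..i} = {..i}"
  proof (rule card_subset_eq)
    show "adj_transp j ` {..i} \<subseteq> {..i}"
      using Cons.prems by (auto simp: Transposition.transpose_def)
    show "card (adj_transp j ` {..i}) = card {..i}"
      by (intro card_image inj_on_subset[OF inj_transpose]) simp
  qed simp
  moreover have "wprod w ` {..i} = {..i}"
    using Cons by simp
  ultimately show ?case
    by (simp only: wprod_Cons image_comp[symmetric])
qed simp

text \<open>The single occurrence of \<open>i\<close> splits the word into two parts that preserve
  \<open>{..i}\<close>, while the letter itself brings in \<open>Suc i\<close>. Hence the
  permutation determines the set of letters.\<close>

lemma wprod_image_atMost_iff:
  assumes "distinct w"
  shows "wprod w ` {..i} = {..i} \<longleftrightarrow> i \<notin> set w"
proof
  assume eq: "wprod w ` {..i} = {..i}"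
  show "i \<notin> set w"
  proof
    assume "i \<in> set w"
    then obtain u v where w: "w = u @ i # v"
      by (meson split_list)
    then have uv: "i \<notin> set u" "i \<notin> set v"
      using assms by auto
    have "wprod u ` (adj_transp i ` (wprod v ` {..i})) = wprod u ` {..i}"
      using eq wprod_image_atMost[OF uv(1)] by (simp add: w wprod_append image_comp)
    then have "adj_transp i ` {..i} = {..i}"
      using bij_wprod[of u] wprod_image_atMost[OF uv(2)] by (simp add: bij_def inj_image_eq_iff)
    moreover have "Suc i \<in> adj_transp i ` {..i}"
      by (metis atMost_iff image_eqI order_refl transpose_apply_first)
    ultimately show False
      by simp
  qed
qed (rule wprod_image_atMost)

text \<open>Any word for the same permutation moves the same initial segments and hence uses all
  letters of \<open>w\<close>.\<close>

lemma perm_length_wprod_distinct: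
  assumes "distinct w" "set w \<subseteq> {1..<n}"
  shows "perm_length n (wprod w) = length w"
proof (rule antisym)
  obtain v where v: "set v \<subseteq> {1..<n}" "wprod v = wprod w" "length v = perm_length n (wprod w)"
    using reduced_word_exists[OF wprod_permutes[OF assms(2)]] .
  have "set w \<subseteq> set v"
    using wprod_image_atMost_iff[OF assms(1)] wprod_image_atMost[of _ v] v(2) by auto
  then have "card (set w) \<le> card (set v)"
    by (intro card_mono) auto
  then show "length w \<le> perm_length n (wprod w)"
    using card_length[of v] distinct_card[OF assms(1)] v(3) by linarith
qed (rule perm_length_wprod_le[OF assms(2)])

section \<open>Subwords and the permutations below a product\<close>

text \<open>A set of letters can stand for a set of positions because the words in question have
  distinct letters; only \<open>S \<inter> set w\<close> matters.\<close>

definition subword :: "nat list \<Rightarrow> nat set \<Rightarrow> nat \<Rightarrow> nat" where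
  "subword w S = wprod (filter (\<lambda>x. x \<in> S) w)"

lemma subword_image_atMost_iff:
  "distinct w \<Longrightarrow> subword w S ` {..i} = {..i} \<longleftrightarrow> i \<notin> S \<inter> set w"
  unfolding subword_def by (subst wprod_image_atMost_iff) auto

lemma subword_eq_iff:
  assumes "distinct w"
  shows "subword w S = subword w T \<longleftrightarrow> S \<inter> set w = T \<inter> set w"
proof
  assume "subword w S = subword w T"
  then have "i \<notin> S \<inter> set w \<longleftrightarrow> i \<notin> T \<inter> set w" for i
    using subword_image_atMost_iff[OF assms, of S i] subword_image_atMost_iff[OF assms, of T i] by simp
  then show "S \<inter> set w = T \<inter> set w"
    by blast
next
  assume "S \<inter> set w = T \<inter> set w"
  then have "filter (\<lambda>x. x \<in> S) w = filter (\<lambda>x. x \<in> T) w"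
    by (intro filter_cong) auto
  then show "subword w S = subword w T"
    by (simp add: subword_def)
qed

lemma subword_permutes: "set w \<subseteq> {1..<n} \<Longrightarrow> subword w S permutes {1..n}"
  unfolding subword_def by (rule wprod_permutes) auto

lemma subword_delete:
  assumes "distinct w" "filter (\<lambda>x. x \<in> S) w = u @ x # v"
  shows "x \<in> S \<inter> set w" "wprod (u @ v) = subword w (S - {x})"
proof -
  have "x \<in> set (filter (\<lambda>x. x \<in> S) w)"
    by (simp add: assms(2))
  then show "x \<in> S \<inter> set w"
    by auto
  have "distinct (u @ x # v)"
    using assms by (metis distinct_filter)
  then have "filter (\<lambda>y. y \<noteq> x) (u @ x # v) = u @ v"
    by (auto simp: filter_id_conv intro!: arg_cong2[of _ _ _ _ "(@)"])
  moreover have "filter (\<lambda>y. y \<noteq> x) (u @ x # v) = filter (\<lambda>y. y \<in> S - {x}) w"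
    unfolding assms(2)[symmetric] filter_filter by (intro filter_cong) auto
  ultimately show "wprod (u @ v) = subword w (S - {x})"
    by (simp add: subword_def)
qed

lemma bruhat_step_subwordD:
  assumes "distinct w" "bruhat_step n \<tau> (subword w S)"
  shows "\<exists>x\<in>S \<inter> set w. \<tau> = subword w (S - {x})"
proof -
  obtain p q where pq: "p < q" "subword w S q < subword w S p"
    "\<tau> = subword w S \<circ> Transposition.transpose p q"
    using assms(2) unfolding bruhat_step_iff by blast
  obtain u x v where u: "filter (\<lambda>x. x \<in> S) w = u @ x # v" "\<tau> = wprod (u @ v)"
    using strong_exchange[OF pq(1) pq(2)[unfolded subword_def]] pq(3) unfolding subword_def by metis
  show ?thesis
    using subword_delete[OF assms(1) u(1)] u(2) by blast
qed

text \<open>Moving the new letter across the part \<open>v\<close> to its right turns it into a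
  transposition of positions, namely of the preimages of \<open>x\<close> and \<open>Suc x\<close>.
  The lengths are the numbers of letters.\<close>

lemma bruhat_step_subword_insert:
  assumes "distinct w" "set w \<subseteq> {1..<n}" "x \<in> set w - S"
  shows "bruhat_step n (subword w S) (subword w (insert x S))"
proof -
  have "x \<in> set (filter (\<lambda>y. y \<in> insert x S) w)"
    using assms(3) by auto
  then obtain u v where uv: "filter (\<lambda>y. y \<in> insert x S) w = u @ x # v"
    by (meson split_list)
  have S: "wprod (u @ v) = subword w S"
    using subword_delete(2)[OF assms(1) uv] assms(3) by simp
  have dist: "distinct (u @ x # v)"
    using assms(1) by (metis distinct_filter uv)
  have set: "set (u @ x # v) \<subseteq> {1..<n}"
    unfolding uv[symmetric] using assms(2) by auto
  then have set': "set (u @ v) \<subseteq> {1..<n}"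
    by auto
  have len: "perm_length n (wprod (u @ v)) < perm_length n (wprod (u @ x # v))"
    using dist set perm_length_wprod_distinct[of "u @ v" n] perm_length_wprod_distinct[of "u @ x # v" n]
    by simp
  have V: "wprod v permutes {1..n}"
    using set by (intro wprod_permutes) auto
  define a b where "a = inv (wprod v) x" and "b = inv (wprod v) (Suc x)"
  have ab: "wprod v a = x" "wprod v b = Suc x"
    using permutes_inverses(1)[OF V] by (auto simp: a_def b_def)
  have "a \<in> {1..n}" "b \<in> {1..n}"
    using set permutes_in_image[OF permutes_inv[OF V]] by (auto simp: a_def b_def)
  moreover have "a \<noteq> b"
    using ab by auto
  moreover have "wprod (u @ v) = wprod (u @ x # v) \<circ> Transposition.transpose a b"
  proof -
    have "adj_transp x \<circ> wprod v = wprod v \<circ> Transposition.transpose a b"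
      using transpose_conj[OF bij_wprod, of v a b] ab by simp
    then show ?thesis
      by (simp add: wprod_append comp_assoc)
  qed
  moreover have "subword w (insert x S) = wprod (u @ x # v)"
    unfolding subword_def uv ..
  ultimately show ?thesis
    unfolding bruhat_step_def S[symmetric]
    using len wprod_permutes[OF set] wprod_permutes[OF set'] by metis
qed

text \<open>Going down, strong exchange deletes one letter at each step; conversely, missing letters
  can be restored one by one.\<close>

lemma bruhat_le_wprod_distinct:
  assumes "distinct w" "set w \<subseteq> {1..<n}"
  shows "bruhat_le n \<tau> (wprod w) \<longleftrightarrow> (\<exists>S. \<tau> = subword w S)"
proof
  have full: "subword w UNIV = wprod w"
    by (simp add: subword_def)
  assume "bruhat_le n \<tau> (wprod w)"
  then show "\<exists>S. \<tau> = subword w S"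
    unfolding bruhat_le_def
  proof (induction rule: converse_rtranclp_induct)
    case base
    show ?case
      using full by metis
  next
    case (step \<rho> \<tau>)
    then show ?case
      using bruhat_step_subwordD[OF assms(1)] by blast
  qed
next
  assume "\<exists>S. \<tau> = subword w S"
  then obtain S where S: "\<tau> = subword w S" ..
  \<comment> \<open>The induction runs over the set \<open>D\<close> of deleted letters.\<close>
  have "bruhat_le n (subword w (set w - D)) (wprod w)" if "finite D" for D
    using that
  proof (induction D)
    case empty
    have "filter (\<lambda>x. x \<in> set w) w = w"
      by (simp add: filter_id_conv)
    then show ?case
      by (simp add: subword_def bruhat_le_def)
  next
    case (insert x D)
    show ?case
    proof (cases "x \<in> set w")
      case True
      then have "insert x (set w - insert x D) = set w - D"
        using insert by auto
      then have "bruhat_step n (subword w (set w - insert x D)) (subword w (set w - D))"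
        using bruhat_step_subword_insert[OF assms, of x "set w - insert x D"] True by simp
      then show ?thesis
        using insert.IH by (rule bruhat_le_step)
    next
      case False
      then have "set w - insert x D = set w - D"
        by auto
      then show ?thesis
        using insert.IH by simp
    qed
  qed
  from this[of "set w - S"] have "bruhat_le n (subword w (set w - (set w - S))) (wprod w)"
    by simp
  moreover have "subword w (set w - (set w - S)) = \<tau>"
    unfolding S subword_eq_iff[OF assms(1)] by auto
  ultimately show "bruhat_le n \<tau> (wprod w)"
    by simp
qed

lemma verts_below_wprod_distinct:
  assumes "distinct w" "set w \<subseteq> {1..<n}"
  shows "verts (bruhat_graph_below n (wprod w)) = range (subword w)"
  unfolding verts_bruhat_graph_below bruhat_le_wprod_distinct[OF assms]
  using subword_permutes[OF assms(2)] by auto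

section \<open>Planarity and the number of letters\<close>

lemma not_planar_if_long_distinct_word:
  assumes "distinct w" "set w \<subseteq> {1..<n}" "4 \<le> length w"
  shows "\<not> planar (bruhat_graph_below n (wprod w))"
proof -
  obtain a b c d v where w: "w = a # b # c # d # v"
    using assms(3) by (auto simp: numeral_eq_Suc Suc_le_length_iff)
  \<comment> \<open>The first four letters are switched on and off independently, all further
    letters being off; this spans a 4-cube.\<close>
  define A where "A p q r s = {x. x = a \<and> p \<or> x = b \<and> q \<or> x = c \<and> r \<or> x = d \<and> s}" for p q r s
  have A: "A p q r s \<inter> set w = A p' q' r' s' \<inter> set w \<longleftrightarrow> p = p' \<and> q = q' \<and> r = r' \<and> s = s'" for p q r s p' q' r' s'
    using assms(1) unfolding w A_def set_eq_iff by auto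
  note V = verts_below_wprod_distinct[OF assms(1,2)]
  have E: "{subword w S, subword w (insert x S)} \<in> undirected_edges (bruhat_graph_below n (wprod w))"
    if "x \<in> set w - S" for S x
    unfolding undirected_edges_bruhat_graph_below V
    using bruhat_step_subword_insert[OF assms(1,2) that] by blast
  have ins: "A True q r s = insert a (A False q r s)" "A p True r s = insert b (A p False r s)"
    "A p q True s = insert c (A p q False s)" "A p q r True = insert d (A p q r False)" for p q r s
    by (auto simp: A_def)
  have new: "a \<in> set w - A False q r s" "b \<in> set w - A p False r s"
    "c \<in> set w - A p q False s" "d \<in> set w - A p q r False" for p q r s
    using assms(1) by (auto simp: A_def w)
  show ?thesis
  proof (rule not_planar_Q4[where f = "\<lambda>p q r s. subword w (A p q r s)"])
    show "subword w (A p q r s) = subword w (A p' q' r' s') \<longleftrightarrow> p = p' \<and> q = q' \<and> r = r' \<and> s = s'"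
      for p q r s p' q' r' s'
      unfolding subword_eq_iff[OF assms(1)] A ..
  qed (simp_all only: ins V rangeI E new)
qed

lemma planar_if_short_distinct_word:
  assumes "distinct w" "set w \<subseteq> {1..<n}" "length w \<le> 3"
  shows "planar (bruhat_graph_below n (wprod w))"
proof -
  have "card (set w) \<le> 3"
    using assms(3) card_length[of w] by linarith
  \<comment> \<open>Fewer than three letters are padded with dummies, so that there are always three
    coordinates; the coordinate of a dummy is constantly \<open>False\<close>.\<close>
  obtain B where "finite B" "card B = 3 - card (set w)" "set w \<inter> B = {}"
    using finite_arbitrarily_large_disj[OF infinite_UNIV_nat, of "set w"] by blast
  with \<open>card (set w) \<le> 3\<close> have "card (set w \<union> B) = 3"
    by (simp add: card_Un_disjoint)
  then obtain a b c where abc: "set w \<subseteq> {a, b, c}" "a \<noteq> b" "a \<noteq> c" "b \<noteq> c"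
    unfolding card_3_iff by blast
  \<comment> \<open>The coordinates are read off from the permutation itself: a letter is present
    exactly if its initial segment is not preserved.\<close>
  define f where "f \<tau> = (\<tau> ` {..a} \<noteq> {..a}, \<tau> ` {..b} \<noteq> {..b}, \<tau> ` {..c} \<noteq> {..c})" for \<tau> :: "nat \<Rightarrow> nat"
  have f: "f (subword w S) = (a \<in> S \<inter> set w, b \<in> S \<inter> set w, c \<in> S \<inter> set w)" for S
    by (simp only: f_def subword_image_atMost_iff[OF assms(1)] not_not)
  note V = verts_below_wprod_distinct[OF assms(1,2)]
  have adj: "Q3_adj (f \<tau>) (f \<rho>) \<and> Q3_adj (f \<rho>) (f \<tau>)"
    if step: "bruhat_step n \<tau> \<rho>" and \<rho>: "\<rho> \<in> range (subword w)" for \<tau> \<rho>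
  proof -
    obtain S where S: "\<rho> = subword w S"
      using \<rho> by auto
    obtain x where "x \<in> S \<inter> set w" "\<tau> = subword w (S - {x})"
      using bruhat_step_subwordD[OF assms(1) step[unfolded S]] by blast
    then show ?thesis
      using abc by (auto simp: S f)
  qed
  show ?thesis
  proof (rule planar_if_subgraph_Q3[of f])
    show "inj_on f (verts (bruhat_graph_below n (wprod w)))"
    proof (rule inj_onI)
      fix \<tau> \<rho> assume "\<tau> \<in> verts (bruhat_graph_below n (wprod w))"
        "\<rho> \<in> verts (bruhat_graph_below n (wprod w))" and eq: "f \<tau> = f \<rho>"
      then obtain S T where ST: "\<tau> = subword w S" "\<rho> = subword w T"
        unfolding V by blast
      then have "S \<inter> set w = T \<inter> set w"
        using eq abc(1) unfolding ST f by blast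
      then show "\<tau> = \<rho>"
        unfolding ST by (simp only: subword_eq_iff[OF assms(1)])
    qed
  next
    fix \<tau> \<rho> assume "{\<tau>, \<rho>} \<in> undirected_edges (bruhat_graph_below n (wprod w))"
    then show "Q3_adj (f \<tau>) (f \<rho>)"
      unfolding undirected_edges_bruhat_graph_below V using adj by (auto simp: doubleton_eq_iff)
  next
    fix e assume "e \<in> undirected_edges (bruhat_graph_below n (wprod w))"
    then show "e \<subseteq> verts (bruhat_graph_below n (wprod w))"
      unfolding undirected_edges_bruhat_graph_below by blast
  qed
qed

section \<open>Pattern avoidance\<close>

lemma contains_321_iff:
  "contains_pattern n \<sigma> 3 (one_line [3, 2, 1]) \<longleftrightarrow>
    (\<exists>i j k. 1 \<le> i \<and> i < j \<and> j < k \<and> k \<le> n \<and> \<sigma> k < \<sigma> j \<and> \<sigma> j < \<sigma> i)" (is "?L \<longleftrightarrow> ?R")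
proof
  have I: "{1..3} = {1, 2, 3::nat}" by auto
  assume ?L
  then obtain \<iota> where \<iota>: "strict_mono_on {1..3} \<iota>" "\<iota> ` {1..3} \<subseteq> {1..n}"
    "\<forall>a\<in>{1..3}. \<forall>b\<in>{1..3}. \<sigma> (\<iota> a) < \<sigma> (\<iota> b) \<longleftrightarrow> one_line [3, 2, 1] a < one_line [3, 2, 1] b"
    by (auto simp: contains_pattern_def)
  have "\<iota> 1 < \<iota> 2" "\<iota> 2 < \<iota> 3"
    using \<iota>(1) by (auto simp: strict_mono_on_def)
  moreover have "\<sigma> (\<iota> 3) < \<sigma> (\<iota> 2)" "\<sigma> (\<iota> 2) < \<sigma> (\<iota> 1)"
    using \<iota>(3) unfolding I by (simp_all add: one_line_def)
  moreover have "1 \<le> \<iota> 1" "\<iota> 3 \<le> n"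
    using \<iota>(2) unfolding I by auto
  ultimately show ?R
    by blast
next
  have I: "{1..3} = {1, 2, 3::nat}" by auto
  assume ?R
  then obtain i j k where ijk: "1 \<le> i" "i < j" "j < k" "k \<le> n" "\<sigma> k < \<sigma> j" "\<sigma> j < \<sigma> i"
    by blast
  show ?L
    unfolding contains_pattern_def I
    by (rule exI[of _ "\<lambda>x. if x = 1 then i else if x = 2 then j else k"])
      (use ijk in \<open>auto simp: strict_mono_on_def one_line_def\<close>)
qed

lemma contains_3412_iff:
  "contains_pattern n \<sigma> 4 (one_line [3, 4, 1, 2]) \<longleftrightarrow>
    (\<exists>i j k l. 1 \<le> i \<and> i < j \<and> j < k \<and> k < l \<and> l \<le> n \<and> \<sigma> k < \<sigma> l \<and> \<sigma> l < \<sigma> i \<and> \<sigma> i < \<sigma> j)"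
  (is "?L \<longleftrightarrow> ?R")
proof
  have I: "{1..4} = {1, 2, 3, 4::nat}" by auto
  assume ?L
  then obtain \<iota> where \<iota>: "strict_mono_on {1..4} \<iota>" "\<iota> ` {1..4} \<subseteq> {1..n}"
    "\<forall>a\<in>{1..4}. \<forall>b\<in>{1..4}. \<sigma> (\<iota> a) < \<sigma> (\<iota> b) \<longleftrightarrow> one_line [3, 4, 1, 2] a < one_line [3, 4, 1, 2] b"
    by (auto simp: contains_pattern_def)
  have "\<iota> 1 < \<iota> 2" "\<iota> 2 < \<iota> 3" "\<iota> 3 < \<iota> 4"
    using \<iota>(1) by (auto simp: strict_mono_on_def)
  moreover have "\<sigma> (\<iota> 3) < \<sigma> (\<iota> 4)" "\<sigma> (\<iota> 4) < \<sigma> (\<iota> 1)" "\<sigma> (\<iota> 1) < \<sigma> (\<iota> 2)"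
    using \<iota>(3) unfolding I by (simp_all add: one_line_def)
  moreover have "1 \<le> \<iota> 1" "\<iota> 4 \<le> n"
    using \<iota>(2) unfolding I by auto
  ultimately show ?R
    by blast
next
  have I: "{1..4} = {1, 2, 3, 4::nat}" by auto
  assume ?R
  then obtain i j k l where ijk: "1 \<le> i" "i < j" "j < k" "k < l" "l \<le> n"
    "\<sigma> k < \<sigma> l" "\<sigma> l < \<sigma> i" "\<sigma> i < \<sigma> j"
    by blast
  show ?L
    unfolding contains_pattern_def I
    by (rule exI[of _ "\<lambda>x. if x = 1 then i else if x = 2 then j else if x = 3 then k else l"])
      (use ijk in \<open>auto simp: strict_mono_on_def one_line_def\<close>)
qed

lemma avoids_321_iff:
  "avoids n \<sigma> [3, 2, 1] \<longleftrightarrow>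
    \<not> (\<exists>i j k. 1 \<le> i \<and> i < j \<and> j < k \<and> k \<le> n \<and> \<sigma> k < \<sigma> j \<and> \<sigma> j < \<sigma> i)"
proof -
  have "length [3, 2, 1::nat] = 3"
    by simp
  then show ?thesis
    unfolding avoids_def contains_321_iff[symmetric] by (simp only:)
qed

lemma avoids_3412_iff:
  "avoids n \<sigma> [3, 4, 1, 2] \<longleftrightarrow>
    \<not> (\<exists>i j k l. 1 \<le> i \<and> i < j \<and> j < k \<and> k < l \<and> l \<le> n \<and> \<sigma> k < \<sigma> l \<and> \<sigma> l < \<sigma> i \<and> \<sigma> i < \<sigma> j)"
proof -
  have "length [3, 4, 1, 2::nat] = 4"
    by simp
  then show ?thesis
    unfolding avoids_def contains_3412_iff[symmetric] by (simp only:)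
qed

section \<open>Removing one entry from a permutation that avoids 321 and 3412\<close>

lemma contains_pattern_trans:
  assumes "strict_mono_on {1..m} \<kappa>" "\<kappa> ` {1..m} \<subseteq> {1..n}"
    and "\<And>a b. a \<in> {1..m} \<Longrightarrow> b \<in> {1..m} \<Longrightarrow> \<sigma> (\<kappa> a) < \<sigma> (\<kappa> b) \<longleftrightarrow> \<tau> a < \<tau> b"
    and "contains_pattern m \<tau> k \<pi>"
  shows "contains_pattern n \<sigma> k \<pi>"
proof -
  obtain \<iota> where \<iota>: "strict_mono_on {1..k} \<iota>" "\<iota> ` {1..k} \<subseteq> {1..m}"
    "\<forall>a\<in>{1..k}. \<forall>b\<in>{1..k}. \<tau> (\<iota> a) < \<tau> (\<iota> b) \<longleftrightarrow> \<pi> a < \<pi> b"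
    using assms(4) unfolding contains_pattern_def by blast
  have mem: "\<iota> a \<in> {1..m}" if "a \<in> {1..k}" for a
    using \<iota>(2) that by blast
  show ?thesis
    unfolding contains_pattern_def
  proof (intro exI[of _ "\<kappa> \<circ> \<iota>"] conjI ballI)
    show "strict_mono_on {1..k} (\<kappa> \<circ> \<iota>)"
      using assms(1) \<iota>(1) mem unfolding strict_mono_on_def comp_apply by blast
    show "(\<kappa> \<circ> \<iota>) ` {1..k} \<subseteq> {1..n}"
      using assms(2) mem by (auto simp: image_subset_iff)
    show "\<sigma> ((\<kappa> \<circ> \<iota>) a) < \<sigma> ((\<kappa> \<circ> \<iota>) b) \<longleftrightarrow> \<pi> a < \<pi> b" if "a \<in> {1..k}" "b \<in> {1..k}" for a b
      using assms(3)[OF mem mem] \<iota>(3) that by simp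
  qed
qed

text \<open>
  If \<open>\<sigma>\<close> moves \<open>n + 1\<close> but neither \<open>\<sigma> n = n + 1\<close> nor \<open>\<sigma> (n + 1) = n\<close>, then the values \<open>n\<close> and \<open>n + 1\<close>
  and the values at the positions \<open>n\<close> and \<open>n + 1\<close> form one of the two patterns.
\<close>

lemma avoids_321_3412_peel:
  assumes \<sigma>: "\<sigma> permutes {1..Suc n}"
    and av: "avoids (Suc n) \<sigma> [3, 2, 1]" "avoids (Suc n) \<sigma> [3, 4, 1, 2]"
  shows "\<exists>\<sigma>'. \<sigma>' permutes {1..n} \<and>
    (\<forall>k \<pi>. contains_pattern n \<sigma>' k \<pi> \<longrightarrow> contains_pattern (Suc n) \<sigma> k \<pi>) \<and>
    (\<sigma> = \<sigma>' \<or> 1 \<le> n \<and> (\<sigma> = adj_transp n \<circ> \<sigma>' \<or> \<sigma> = \<sigma>' \<circ> adj_transp n))"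
proof -
  have restrict: "\<tau> permutes {1..n}" if "\<tau> permutes {1..Suc n}" "\<tau> (Suc n) = Suc n" for \<tau>
  proof (rule permutes_superset[OF that(1)])
    show "\<And>x. x \<in> {1..Suc n} - {1..n} \<Longrightarrow> \<tau> x = x"
      using that(2) by (metis Diff_iff atLeastAtMost_iff le_Suc_eq)
  qed
  have inj: "\<sigma> a = \<sigma> b \<longleftrightarrow> a = b" for a b
    using \<sigma> by (metis permutes_inj injD)
  have mem: "\<sigma> a \<in> {1..Suc n} \<longleftrightarrow> a \<in> {1..Suc n}" for a
    by (rule permutes_in_image[OF \<sigma>])
  have no321: "\<not> (1 \<le> i \<and> i < j \<and> j < k \<and> k \<le> Suc n \<and> \<sigma> k < \<sigma> j \<and> \<sigma> j < \<sigma> i)" for i j k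
    using av(1) unfolding avoids_321_iff by blast
  have no3412: "\<not> (1 \<le> i \<and> i < j \<and> j < k \<and> k < l \<and> l \<le> Suc n \<and> \<sigma> k < \<sigma> l \<and> \<sigma> l < \<sigma> i \<and> \<sigma> i < \<sigma> j)"
    for i j k l
    using av(2) unfolding avoids_3412_iff by blast
  have perm_st: "adj_transp n permutes {1..Suc n}" if "1 \<le> n"
    using that by (intro permutes_swap_id) auto
  consider (corner) "\<sigma> (Suc n) = Suc n" | (pos) "1 \<le> n" "\<sigma> n = Suc n" | (val) "1 \<le> n" "\<sigma> (Suc n) = n"
  proof (rule ccontr)
    assume "\<not> thesis"
    then have c: "\<sigma> (Suc n) \<noteq> Suc n" "1 \<le> n \<Longrightarrow> \<sigma> n \<noteq> Suc n" "1 \<le> n \<Longrightarrow> \<sigma> (Suc n) \<noteq> n"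
      using that by blast+
    have "n \<noteq> 0"
      using c(1) mem[of 1] by (intro notI) auto
    then have n: "1 \<le> n" by simp
    obtain p where p: "\<sigma> p = Suc n"
      using permutes_surj[OF \<sigma>] by (metis surjD)
    obtain r where r: "\<sigma> r = n"
      using permutes_surj[OF \<sigma>] by (metis surjD)
    have pr: "p \<in> {1..Suc n}" "r \<in> {1..Suc n}"
      using mem[of p] mem[of r] p r n by auto
    have p': "p < n"
      using p pr(1) c(1) c(2)[OF n] by (metis atLeastAtMost_iff le_SucE nat_less_le)
    have q: "\<sigma> (Suc n) < n" "\<sigma> n < Suc n"
      using mem[of "Suc n"] mem[of n] n c(1) c(2)[OF n] c(3)[OF n] by auto
    \<comment> \<open>Otherwise the positions \<open>p\<close>, \<open>n\<close>,
      \<open>Suc n\<close> form 321.\<close>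
    have 1: "\<sigma> n < \<sigma> (Suc n)"
      using no321[of p n "Suc n"] p pr p' q inj[of n "Suc n"] by auto
    have "r \<noteq> Suc n" "r \<noteq> n" "r \<noteq> p"
      using r p q 1 by auto
    \<comment> \<open>Otherwise the values \<open>Suc n\<close>, \<open>n\<close> and
      \<open>\<sigma> (Suc n)\<close> form 321.\<close>
    moreover have "\<not> p < r"
      using no321[of p r "Suc n"] p r pr q \<open>r \<noteq> Suc n\<close> by auto
    ultimately have "r < p"
      by simp
    \<comment> \<open>The positions \<open>r\<close>, \<open>p\<close>, \<open>n\<close>,
      \<open>Suc n\<close> now form 3412.\<close>
    then show False
      using no3412[of r p n "Suc n"] p r pr p' q 1 by auto
  qed
  then show ?thesis
  proof cases
    case corner
    have "contains_pattern (Suc n) \<sigma> k \<pi>" if "contains_pattern n \<sigma> k \<pi>" for k \<pi>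
      using that by (rule contains_pattern_trans[of n id, rotated 3]) (auto simp: strict_mono_on_def)
    then show ?thesis
      using restrict[OF \<sigma> corner] by (intro exI[of _ \<sigma>]) simp
  next
    case pos
    \<comment> \<open>The largest value sits at position \<open>n\<close> and is deleted;
      \<open>?\<kappa>\<close> skips that position.\<close>
    let ?\<sigma>' = "\<sigma> \<circ> adj_transp n" and ?\<kappa> = "\<lambda>x. if x = n then Suc n else x"
    have perm: "?\<sigma>' permutes {1..n}"
      using pos by (intro restrict permutes_compose[OF perm_st \<sigma>]) auto
    have "\<sigma> (?\<kappa> a) = ?\<sigma>' a" if "a \<in> {1..n}" for a
      using that by (auto simp: Transposition.transpose_def)
    then have cp: "contains_pattern (Suc n) \<sigma> k \<pi>" if "contains_pattern n ?\<sigma>' k \<pi>" for k \<pi>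
      using that by (intro contains_pattern_trans[of n ?\<kappa> "Suc n" \<sigma> ?\<sigma>']) (auto simp: strict_mono_on_def)
    have "\<sigma> = ?\<sigma>' \<circ> adj_transp n"
      by (simp add: comp_assoc)
    with perm cp pos(1) show ?thesis
      by blast
  next
    case val
    \<comment> \<open>The last entry, of value \<open>n\<close>, is deleted and the value
      \<open>Suc n\<close> is lowered to \<open>n\<close>; the order of the remaining entries does
      not change.\<close>
    let ?\<sigma>' = "adj_transp n \<circ> \<sigma>"
    have perm: "?\<sigma>' permutes {1..n}"
      using val by (intro restrict permutes_compose[OF \<sigma> perm_st]) auto
    have "\<sigma> a < \<sigma> b \<longleftrightarrow> ?\<sigma>' a < ?\<sigma>' b" if ab: "a \<in> {1..n}" "b \<in> {1..n}" for a b
    proof -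
      have "\<sigma> a \<noteq> n" "\<sigma> b \<noteq> n" "\<sigma> a \<le> Suc n" "\<sigma> b \<le> Suc n"
        using ab inj[of a "Suc n"] inj[of b "Suc n"] val(2) mem[of a] mem[of b] by auto
      then show ?thesis
        by (auto simp: Transposition.transpose_def)
    qed
    then have cp: "contains_pattern (Suc n) \<sigma> k \<pi>" if "contains_pattern n ?\<sigma>' k \<pi>" for k \<pi>
      using that by (intro contains_pattern_trans[of n id "Suc n" \<sigma> ?\<sigma>']) (auto simp: strict_mono_on_def)
    have "\<sigma> = adj_transp n \<circ> ?\<sigma>'"
      by (simp flip: comp_assoc)
    with perm cp val(1) show ?thesis
      by blast
  qed
qed

lemma avoids_peel:
  assumes "\<And>k \<pi>. contains_pattern n \<sigma>' k \<pi> \<Longrightarrow> contains_pattern m \<sigma> k \<pi>" "avoids m \<sigma> xs"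
  shows "avoids n \<sigma>' xs"
  using assms unfolding avoids_def by blast

lemma distinct_word_peel:
  assumes "distinct w" "set w \<subseteq> {1..<n}" "\<sigma>' = wprod w"
    and "\<sigma> = \<sigma>' \<or> 1 \<le> n \<and> (\<sigma> = adj_transp n \<circ> \<sigma>' \<or> \<sigma> = \<sigma>' \<circ> adj_transp n)"
  shows "\<exists>v. distinct v \<and> set v \<subseteq> {1..<Suc n} \<and> \<sigma> = wprod v \<and> length v \<le> Suc (length w)"
proof -
  have n: "n \<notin> set w" "set w \<subseteq> {1..<Suc n}"
    using assms(2) by auto
  have "\<sigma> = wprod w \<or> 1 \<le> n \<and> (\<sigma> = wprod (n # w) \<or> \<sigma> = wprod (w @ [n]))"
    using assms(3,4) by (simp add: wprod_append)
  then show ?thesis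
  proof (elim disjE conjE)
    assume "\<sigma> = wprod w"
    then show ?thesis
      using assms n by (intro exI[of _ w]) simp
  next
    assume "1 \<le> n" "\<sigma> = wprod (n # w)"
    then show ?thesis
      using assms n by (intro exI[of _ "n # w"]) auto
  next
    assume "1 \<le> n" "\<sigma> = wprod (w @ [n])"
    then show ?thesis
      using assms n by (intro exI[of _ "w @ [n]"]) auto
  qed
qed

lemma avoids_321_3412_distinct_word:
  assumes "\<sigma> permutes {1..n}" "avoids n \<sigma> [3, 2, 1]" "avoids n \<sigma> [3, 4, 1, 2]"
  shows "\<exists>w. distinct w \<and> set w \<subseteq> {1..<n} \<and> \<sigma> = wprod w"
  using assms
proof (induction n arbitrary: \<sigma>)
  case 0
  then show ?case
    by (intro exI[of _ "[]"]) (simp add: permutes_empty)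
next
  case (Suc n)
  obtain \<sigma>' where \<sigma>': "\<sigma>' permutes {1..n}"
    and cp: "\<And>k \<pi>. contains_pattern n \<sigma>' k \<pi> \<Longrightarrow> contains_pattern (Suc n) \<sigma> k \<pi>"
    and eq: "\<sigma> = \<sigma>' \<or> 1 \<le> n \<and> (\<sigma> = adj_transp n \<circ> \<sigma>' \<or> \<sigma> = \<sigma>' \<circ> adj_transp n)"
    using avoids_321_3412_peel[OF Suc.prems] by blast
  obtain w where "distinct w" "set w \<subseteq> {1..<n}" "\<sigma>' = wprod w"
    using Suc.IH[OF \<sigma>' avoids_peel[OF cp Suc.prems(2)] avoids_peel[OF cp Suc.prems(3)]] by blast
  from distinct_word_peel[OF this eq] show ?case
    by blast
qed

section \<open>Products of four distinct adjacent transpositions\<close>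

definition boolean_patterns :: "nat list list" where
  "boolean_patterns = [[2,3,4,5,1], [2,3,5,1,4],
      [2,4,1,5,3], [2,5,1,3,4], [3,1,4,5,2], [3,1,5,2,4],
      [4,1,2,5,3], [5,1,2,3,4], [2,3,4,1,6,5], [2,3,1,5,6,4],
      [2,3,1,6,4,5], [2,4,1,3,6,5], [2,1,4,5,6,3], [2,1,4,6,3,5],
      [2,1,5,3,6,4], [2,1,6,3,4,5], [3,1,4,2,6,5], [3,1,2,5,6,4],
      [3,1,2,6,4,5], [4,1,2,3,6,5], [2,3,1,5,4,7,6], [2,1,4,3,6,7,5],
      [2,1,4,3,7,5,6], [2,1,4,5,3,7,6], [2,1,5,3,4,7,6], [3,1,2,5,4,7,6],
      [2,1,4,3,6,5,8,7]]"

text \<open>The 24 orders are written out so that evaluation can run through them.\<close>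

definition words_of_four :: "'a \<Rightarrow> 'a \<Rightarrow> 'a \<Rightarrow> 'a \<Rightarrow> 'a list list" where
  "words_of_four a b c d = [[a, b, c, d], [a, b, d, c], [a, c, b, d], [a, c, d, b], [a, d, b, c], [a, d, c, b],
    [b, a, c, d], [b, a, d, c], [b, c, a, d], [b, c, d, a], [b, d, a, c], [b, d, c, a],
    [c, a, b, d], [c, a, d, b], [c, b, a, d], [c, b, d, a], [c, d, a, b], [c, d, b, a],
    [d, a, b, c], [d, a, c, b], [d, b, a, c], [d, b, c, a], [d, c, a, b], [d, c, b, a]]"

lemma distinct_words_of_four:
  assumes "distinct w" "set w = {a, b, c, d}" "distinct [a, b, c, d]"
  shows "w \<in> set (words_of_four a b c d)"
proof -
  have "length w = 4"
    using assms distinct_card[OF assms(1)] by simp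
  then obtain x y z u where w: "w = [x, y, z, u]"
    by (auto simp: numeral_eq_Suc length_Suc_conv)
  then have "x \<in> {a, b, c, d}" "y \<in> {a, b, c, d}" "z \<in> {a, b, c, d}" "u \<in> {a, b, c, d}"
    using assms(2) by auto
  then show ?thesis
    using assms(1) unfolding w words_of_four_def by (elim insertE emptyE) simp_all
qed

text \<open>The eight letter sets start at 1 and have gaps 1 or 2, where 2 stands for letters that
  are not adjacent. With largest letter \<open>m\<close> the product acts on
  \<open>{1..m + 1}\<close>, hence the excluded bound \<open>m + 2\<close>.\<close>

lemma map_wprod_words_of_four:
  "\<forall>w\<in>set (words_of_four 1 2 3 4). map (wprod w) [1..<4 + 2] \<in> set boolean_patterns"
  "\<forall>w\<in>set (words_of_four 1 2 3 5). map (wprod w) [1..<5 + 2] \<in> set boolean_patterns"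
  "\<forall>w\<in>set (words_of_four 1 2 4 5). map (wprod w) [1..<5 + 2] \<in> set boolean_patterns"
  "\<forall>w\<in>set (words_of_four 1 2 4 6). map (wprod w) [1..<6 + 2] \<in> set boolean_patterns"
  "\<forall>w\<in>set (words_of_four 1 3 4 5). map (wprod w) [1..<5 + 2] \<in> set boolean_patterns"
  "\<forall>w\<in>set (words_of_four 1 3 4 6). map (wprod w) [1..<6 + 2] \<in> set boolean_patterns"
  "\<forall>w\<in>set (words_of_four 1 3 5 6). map (wprod w) [1..<6 + 2] \<in> set boolean_patterns"
  "\<forall>w\<in>set (words_of_four 1 3 5 7). map (wprod w) [1..<7 + 2] \<in> set boolean_patterns"
  by code_simp+

lemma map_wprod_in_boolean_patterns:
  assumes "e2 \<in> {2, 3}" "e3 \<in> {e2 + 1, e2 + 2}" "e4 \<in> {e3 + 1, e3 + 2}"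
    and "distinct w" "set w = {1, e2, e3, e4}"
  shows "map (wprod w) [1..<e4 + 2] \<in> set boolean_patterns"
proof -
  have e2: "e2 = 2 \<or> e2 = 3" and e3: "e3 = e2 + 1 \<or> e3 = e2 + 2" and e4: "e4 = e3 + 1 \<or> e4 = e3 + 2"
    using assms(1-3) by simp_all
  have "distinct [1, e2, e3, e4]"
    using e2 e3 e4 by auto
  then have w: "w \<in> set (words_of_four 1 e2 e3 e4)"
    by (rule distinct_words_of_four[OF assms(4,5)])
  consider "e2 = 2" "e3 = 3" "e4 = 4"
    | "e2 = 2" "e3 = 3" "e4 = 5"
    | "e2 = 2" "e3 = 4" "e4 = 5"
    | "e2 = 2" "e3 = 4" "e4 = 6"
    | "e2 = 3" "e3 = 4" "e4 = 5"
    | "e2 = 3" "e3 = 4" "e4 = 6"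
    | "e2 = 3" "e3 = 5" "e4 = 6"
    | "e2 = 3" "e3 = 5" "e4 = 7"
    using e2 e3 e4 by (elim disjE) simp_all
  then show ?thesis
  proof cases
    case 1
    show ?thesis
      using map_wprod_words_of_four(1) w unfolding 1 by (rule bspec)
  next
    case 2
    show ?thesis
      using map_wprod_words_of_four(2) w unfolding 2 by (rule bspec)
  next
    case 3
    show ?thesis
      using map_wprod_words_of_four(3) w unfolding 3 by (rule bspec)
  next
    case 4
    show ?thesis
      using map_wprod_words_of_four(4) w unfolding 4 by (rule bspec)
  next
    case 5
    show ?thesis
      using map_wprod_words_of_four(5) w unfolding 5 by (rule bspec)
  next
    case 6
    show ?thesis
      using map_wprod_words_of_four(6) w unfolding 6 by (rule bspec)
  next
    case 7
    show ?thesis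
      using map_wprod_words_of_four(7) w unfolding 7 by (rule bspec)
  next
    case 8
    show ?thesis
      using map_wprod_words_of_four(8) w unfolding 8 by (rule bspec)
  qed
qed

section \<open>Inversions of patterns and of products\<close>

fun inv_count :: "nat list \<Rightarrow> nat" where
  "inv_count [] = 0"
| "inv_count (x # xs) = length (filter (\<lambda>y. y < x) xs) + inv_count xs"

lemma boolean_patterns_inv_count: "\<forall>xs\<in>set boolean_patterns. inv_count xs = 4"
  by (simp add: boolean_patterns_def)

text \<open>The set \<open>?A\<close> holds the inversions with the first entry and
  \<open>?B\<close> the shifted inversions of the tail; indices start at 0.\<close>

lemma inv_count_le_card:
  "inv_count xs \<le> card {(a, b). a < b \<and> b < length xs \<and> xs ! b < xs ! a}"
proof (induction xs)
  case (Cons x xs)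
  let ?I = "\<lambda>ys. {(a, b). a < b \<and> b < length ys \<and> ys ! b < ys ! a}"
  let ?A = "(\<lambda>b. (0::nat, Suc b)) ` {b. b < length xs \<and> xs ! b < x}"
  let ?B = "map_prod Suc Suc ` ?I xs"
  have fin: "finite (?I ys)" for ys :: "nat list"
    by (rule finite_subset[of _ "{..<length ys} \<times> {..<length ys}"]) auto
  have "card (?A \<union> ?B) = card ?A + card ?B"
    using fin[of xs] by (intro card_Un_disjoint) auto
  also have "card ?A = length (filter (\<lambda>y. y < x) xs)"
    by (simp add: card_image inj_on_def length_filter_conv_card)
  also have "card ?B = card (?I xs)"
    by (intro card_image inj_onI) (auto simp: map_prod_def)
  finally have "inv_count (x # xs) \<le> card (?A \<union> ?B)"
    using Cons.IH by simp
  also have "\<dots> \<le> card (?I (x # xs))"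
    by (intro card_mono fin) auto
  finally show ?case .
qed simp

text \<open>A new first letter \<open>i\<close> reverses the order of just one pair of values, so
  the only inversion it can add is at the preimages of \<open>i\<close> and
  \<open>Suc i\<close>.\<close>

lemma card_inversions_wprod:
  "finite {(p, q). p < q \<and> wprod w q < wprod w p} \<and>
   card {(p, q). p < q \<and> wprod w q < wprod w p} \<le> length w"
proof (induction w)
  case (Cons i w)
  let ?I = "\<lambda>w. {(p, q). p < q \<and> wprod w q < wprod w p}"
  let ?x = "(inv (wprod w) i, inv (wprod w) (Suc i))"
  have "(p, q) = ?x" if pq: "p < q" "wprod (i # w) q < wprod (i # w) p" and n: "\<not> wprod w q < wprod w p"
    for p q
  proof -
    have "wprod w p \<noteq> wprod w q"
      using pq(1) bij_wprod[of w] by (auto simp: bij_def inj_eq)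
    then have "wprod w p = i" "wprod w q = Suc i"
      using pq(2) n by (auto simp: Transposition.transpose_def split: if_splits)
    then show ?thesis
      using bij_wprod[of w] by (metis bij_def inv_f_f)
  qed
  then have "?I (i # w) \<subseteq> insert ?x (?I w)"
    by blast
  moreover have "finite (insert ?x (?I w))" "card (insert ?x (?I w)) \<le> Suc (length w)"
    using Cons by (auto simp: card_insert_if)
  ultimately show ?case
    by (metis (no_types, lifting) card_mono finite_subset length_Cons order_trans)
next
  case Nil
  have "{(p, q). p < q \<and> wprod [] q < wprod [] p} = {}"
    by auto
  then show ?case
    by (simp only: finite.emptyI card.empty le0 simp_thms)
qed

text \<open>An occurrence carries the inversions of the pattern injectively to inversions of the
  product, and there are at most as many of these as letters.\<close>

lemma inv_count_le_length_if_contains: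
  assumes "contains_pattern n (wprod w) (length xs) (one_line xs)"
  shows "inv_count xs \<le> length w"
proof -
  let ?I = "{(p, q). p < q \<and> wprod w q < wprod w p}"
  let ?J = "{(a, b). a < b \<and> b < length xs \<and> xs ! b < xs ! a}"
  obtain \<iota> where mono: "strict_mono_on {1..length xs} \<iota>"
    and ord: "\<forall>a\<in>{1..length xs}. \<forall>b\<in>{1..length xs}.
      wprod w (\<iota> a) < wprod w (\<iota> b) \<longleftrightarrow> one_line xs a < one_line xs b"
    using assms unfolding contains_pattern_def by blast
  let ?f = "\<lambda>(a, b). (\<iota> (Suc a), \<iota> (Suc b))"
  have inj: "inj_on \<iota> {1..length xs}"
    using mono by (rule strict_mono_on_imp_inj_on)
  have "\<iota> (Suc a) = \<iota> (Suc b) \<longleftrightarrow> a = b" if "a < length xs" "b < length xs" for a b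
    using inj_on_eq_iff[OF inj, of "Suc a" "Suc b"] that by simp
  then have "inj_on ?f ?J"
    by (auto intro!: inj_onI)
  then have "card ?J = card (?f ` ?J)"
    by (simp add: card_image)
  also have "\<dots> \<le> card ?I"
  proof (rule card_mono)
    show "?f ` ?J \<subseteq> ?I"
    proof clarsimp
      fix a b assume ab: "a < b" "b < length xs" "xs ! b < xs ! a"
      have "one_line xs (Suc b) < one_line xs (Suc a)"
        using ab by (simp add: one_line_def)
      then show "\<iota> (Suc a) < \<iota> (Suc b) \<and> wprod w (\<iota> (Suc b)) < wprod w (\<iota> (Suc a))"
        using ab ord mono by (auto simp: strict_mono_on_def)
    qed
  qed (use card_inversions_wprod in blast)
  finally show ?thesis
    using inv_count_le_card[of xs] card_inversions_wprod[of w] by linarith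
qed

section \<open>Compression of a word of four letters\<close>

text \<open>As \<open>\<iota>\<close> keeps \<open>j\<close> and \<open>Suc j\<close> consecutive
  for every letter \<open>j\<close>, it intertwines the transposition at \<open>j\<close> with the
  one at \<open>\<iota> j\<close>; injectivity takes care of all other values.\<close>

lemma wprod_map:
  assumes "inj_on \<iota> {1..k}" "\<And>j. j \<in> set w \<Longrightarrow> 1 \<le> j \<and> j < k \<and> \<iota> (Suc j) = Suc (\<iota> j)" "x \<in> {1..k}"
  shows "wprod (map \<iota> w) (\<iota> x) = \<iota> (wprod w x)"
  using assms(2)
proof (induction w)
  case (Cons j w)
  have "set w \<subseteq> {1..<k}"
    using Cons.prems by auto
  then have y: "wprod w x \<in> {1..k}"
    using permutes_in_image[OF wprod_permutes] assms(3) by blast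
  have j: "j \<in> {1..k}" "Suc j \<in> {1..k}" "\<iota> (Suc j) = Suc (\<iota> j)"
    using Cons.prems[of j] by auto
  have "adj_transp (\<iota> j) (\<iota> (wprod w x)) = \<iota> (adj_transp j (wprod w x))"
    using inj_on_eq_iff[OF assms(1) y j(1)] inj_on_eq_iff[OF assms(1) y j(2)] j(3)
    by (auto simp: Transposition.transpose_def)
  with Cons show ?case
    by simp
qed simp

text \<open>
  The four letters of the word are moved as close together as their adjacencies permit; this
  deletes the fixed points of the permutation that separate them.
\<close>

lemma length_four_word_contains_pattern:
  assumes "distinct w" "set w \<subseteq> {1..<n}" "length w = 4"
  shows "\<exists>xs\<in>set boolean_patterns. contains_pattern n (wprod w) (length xs) (one_line xs)"
proof -
  define ls where "ls = sort w"
  then have ls: "length ls = 4" "distinct ls" "sorted ls" "set ls = set w"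
    using assms by auto
  from ls(1) obtain l1 l2 l3 l4 where l: "ls = [l1, l2, l3, l4]"
    by (auto simp: numeral_eq_Suc length_Suc_conv)
  have less: "l1 < l2" "l2 < l3" "l3 < l4"
    using ls(2,3) unfolding l by auto
  have setw: "set w = {l1, l2, l3, l4}"
    using ls(4) unfolding l by simp
  have bounds: "1 \<le> l1" "l4 < n"
    using assms(2) setw by auto
  \<comment> \<open>The compressed letters are 1, \<open>e2\<close>, \<open>e3\<close>,
    \<open>e4\<close>: a gap of 1 is kept and any larger gap becomes 2.\<close>
  define e2 where "e2 = (if l2 = Suc l1 then 2 else 3 :: nat)"
  define e3 where "e3 = e2 + (if l3 = Suc l2 then 1 else 2)"
  define e4 where "e4 = e3 + (if l4 = Suc l3 then 1 else 2)"
  \<comment> \<open>This increasing map sends each compressed letter and its successor to the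
    original letter and its successor; \<open>g\<close> inverts it on the letters.\<close>
  define \<iota> where "\<iota> x = (if e4 \<le> x then l4 + (x - e4) else if e3 \<le> x then l3 + (x - e3)
    else if e2 \<le> x then l2 + (x - e2) else l1 + (x - 1))" for x
  define g where "g l = (if l = l1 then 1 else if l = l2 then e2 else if l = l3 then e3 else e4)" for l
  have e: "1 < e2" "e2 < e3" "e3 < e4"
    by (auto simp: e2_def e3_def e4_def)
  have gaps: "e2 = 2 \<and> l2 = Suc l1 \<or> e2 = 3 \<and> Suc l1 < l2"
    "e3 = e2 + 1 \<and> l3 = Suc l2 \<or> e3 = e2 + 2 \<and> Suc l2 < l3"
    "e4 = e3 + 1 \<and> l4 = Suc l3 \<or> e4 = e3 + 2 \<and> Suc l3 < l4"
    using less by (auto simp: e2_def e3_def e4_def)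
  \<comment> \<open>The largest compressed letter moves \<open>e4\<close> and \<open>Suc e4\<close>,
    so the pattern has \<open>Suc e4\<close> entries.\<close>
  let ?k = "Suc e4" and ?w = "map g w"
  have step: "\<iota> x < \<iota> (Suc x)" if "1 \<le> x" "x \<le> e4" for x
    using that gaps unfolding \<iota>_def by (elim disjE conjE) auto
  have mono: "strict_mono_on {1..?k} \<iota>"
  proof (rule strict_mono_onI)
    fix r s assume "r \<in> {1..?k}" "s \<in> {1..?k}" "r < s"
    then show "\<iota> r < \<iota> s"
    proof (induction s)
      case (Suc s)
      have "\<iota> s < \<iota> (Suc s)"
        using Suc.prems step[of s] by auto
      then show ?case
        using Suc by (cases "r = s") auto
    qed simp
  qed
  have inj: "inj_on \<iota> {1..?k}"
    using mono by (rule strict_mono_on_imp_inj_on)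
  have le: "\<iota> a \<le> \<iota> b" if "a \<in> {1..?k}" "b \<in> {1..?k}" "a \<le> b" for a b
    using strict_mono_onD[OF mono that(1,2)] that(3) by (cases "a = b") auto
  have ends: "\<iota> 1 = l1" "\<iota> ?k = Suc l4"
    using e by (auto simp: \<iota>_def)
  have im: "\<iota> ` {1..?k} \<subseteq> {1..n}"
  proof
    fix y assume "y \<in> \<iota> ` {1..?k}"
    then obtain a where "a \<in> {1..?k}" "y = \<iota> a" by blast
    then show "y \<in> {1..n}"
      using le[of 1 a] le[of a ?k] ends bounds by auto
  qed
  have letters: "\<iota> 1 = l1 \<and> \<iota> 2 = Suc l1" "\<iota> e2 = l2 \<and> \<iota> (Suc e2) = Suc l2"
    "\<iota> e3 = l3 \<and> \<iota> (Suc e3) = Suc l3" "\<iota> e4 = l4 \<and> \<iota> (Suc e4) = Suc l4"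
    using gaps less unfolding \<iota>_def by (auto; fail)+
  have g: "g l1 = 1" "g l2 = e2" "g l3 = e3" "g l4 = e4"
    using less by (auto simp: g_def)
  have setg: "set ?w = {1, e2, e3, e4}"
    using g by (simp add: setw)
  have "inj_on g (set w)"
    unfolding setw using e by (auto simp: inj_on_def g)
  then have distg: "distinct ?w"
    using assms(1) by (simp add: distinct_map)
  have w: "map \<iota> ?w = w"
    using setw letters g by (auto intro!: map_idI)
  have eq: "wprod w (\<iota> a) = \<iota> (wprod ?w a)" if "a \<in> {1..?k}" for a
  proof -
    have "1 \<le> j \<and> j < ?k \<and> \<iota> (Suc j) = Suc (\<iota> j)" if "j \<in> set ?w" for j
      using that e letters unfolding setg by (auto simp: numeral_2_eq_2)
    then show ?thesis
      using wprod_map[OF inj _ that, of ?w] unfolding w by blast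
  qed
  have perm: "wprod ?w permutes {1..?k}"
    using setg e by (intro wprod_permutes) auto
  let ?xs = "map (wprod ?w) [1..<e4 + 2]"
  have len: "length ?xs = ?k"
    by simp
  have one: "one_line ?xs a = wprod ?w a" if "a \<in> {1..?k}" for a
    using that unfolding one_line_def by (auto simp del: upt_Suc)
  have "contains_pattern n (wprod w) ?k (one_line ?xs)"
    unfolding contains_pattern_def
  proof (intro exI[of _ \<iota>] conjI ballI mono im)
    fix a b assume ab: "a \<in> {1..?k}" "b \<in> {1..?k}"
    then have "wprod ?w a \<in> {1..?k}" "wprod ?w b \<in> {1..?k}"
      using permutes_in_image[OF perm] by auto
    then have "\<iota> (wprod ?w a) < \<iota> (wprod ?w b) \<longleftrightarrow> wprod ?w a < wprod ?w b"
      using strict_mono_onD[OF mono] by (metis less_asym linorder_neqE_nat)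
    then show "wprod w (\<iota> a) < wprod w (\<iota> b) \<longleftrightarrow> one_line ?xs a < one_line ?xs b"
      by (simp only: eq one ab)
  qed
  moreover have "?xs \<in> set boolean_patterns"
  proof (rule map_wprod_in_boolean_patterns[OF _ _ _ distg setg])
    show "e2 \<in> {2, 3}" "e3 \<in> {e2 + 1, e2 + 2}" "e4 \<in> {e3 + 1, e3 + 2}"
      using gaps by auto
  qed
  ultimately show ?thesis
    using len by metis
qed

section \<open>Planarity in terms of the patterns\<close>

text \<open>In the induction on \<open>n\<close> the word grows by at most one letter, so to get
  past length 3 it would need length exactly 4, and then one of the patterns occurs.\<close>

lemma avoids_all_short_word:
  assumes "\<sigma> permutes {1..n}" "avoids n \<sigma> [3, 2, 1]" "avoids n \<sigma> [3, 4, 1, 2]"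
    and "\<forall>xs\<in>set boolean_patterns. avoids n \<sigma> xs"
  shows "\<exists>w. distinct w \<and> set w \<subseteq> {1..<n} \<and> \<sigma> = wprod w \<and> length w \<le> 3"
  using assms
proof (induction n arbitrary: \<sigma>)
  case 0
  then show ?case
    by (intro exI[of _ "[]"]) simp
next
  case (Suc n)
  obtain \<sigma>' where \<sigma>': "\<sigma>' permutes {1..n}"
    and cp: "\<And>k \<pi>. contains_pattern n \<sigma>' k \<pi> \<Longrightarrow> contains_pattern (Suc n) \<sigma> k \<pi>"
    and eq: "\<sigma> = \<sigma>' \<or> 1 \<le> n \<and> (\<sigma> = adj_transp n \<circ> \<sigma>' \<or> \<sigma> = \<sigma>' \<circ> adj_transp n)"
    using avoids_321_3412_peel[OF Suc.prems(1-3)] by blast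
  have "\<forall>xs\<in>set boolean_patterns. avoids n \<sigma>' xs"
    using Suc.prems(4) avoids_peel[OF cp] by blast
  then obtain w where w: "distinct w" "set w \<subseteq> {1..<n}" "\<sigma>' = wprod w" "length w \<le> 3"
    using Suc.IH[OF \<sigma>' avoids_peel[OF cp Suc.prems(2)] avoids_peel[OF cp Suc.prems(3)]] by blast
  obtain v where v: "distinct v" "set v \<subseteq> {1..<Suc n}" "\<sigma> = wprod v" "length v \<le> Suc (length w)"
    using distinct_word_peel[OF w(1-3) eq] by blast
  have "length v \<noteq> 4"
    using length_four_word_contains_pattern[OF v(1,2)] Suc.prems(4) v(3) by (auto simp: avoids_def)
  then show ?case
    using v w(4) by (intro exI[of _ v]) auto
qed

lemma planar_bruhat_graph_below_iff:
  assumes "\<sigma> permutes {1..n}"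
  shows "planar (bruhat_graph_below n \<sigma>) \<longleftrightarrow>
    avoids n \<sigma> [3, 2, 1] \<and> avoids n \<sigma> [3, 4, 1, 2] \<and> (\<forall>xs\<in>set boolean_patterns. avoids n \<sigma> xs)"
    (is "planar ?B \<longleftrightarrow> ?av")
proof
  assume ?av
  then obtain w where "distinct w" "set w \<subseteq> {1..<n}" "\<sigma> = wprod w" "length w \<le> 3"
    using avoids_all_short_word[OF assms] by blast
  then show "planar ?B"
    using planar_if_short_distinct_word by blast
next
  assume planar: "planar ?B"
  have refl: "bruhat_le n \<sigma> \<sigma>"
    by (simp add: bruhat_le_def)
  have 1: "avoids n \<sigma> [3, 2, 1]"
    unfolding avoids_321_iff using not_planar_if_321_below[OF assms refl] planar by blast
  have False if ijkl: "1 \<le> i" "i < j" "j < k" "k < l" "l \<le> n" "\<sigma> k < \<sigma> l" "\<sigma> l < \<sigma> i" "\<sigma> i < \<sigma> j"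
    for i j k l
  proof -
    \<comment> \<open>Exchanging the 3 and the 1 of the occurrence gives 1432, whose last three
      entries form 321.\<close>
    let ?\<tau> = "\<sigma> \<circ> Transposition.transpose i k"
    have step: "bruhat_step n ?\<tau> \<sigma>"
      using ijkl by (intro bruhat_stepI[OF assms]) auto
    have less: "?\<tau> l < ?\<tau> k" "?\<tau> k < ?\<tau> j"
      using ijkl by (auto simp: Transposition.transpose_def)
    have perm: "?\<tau> permutes {1..n}"
      using step by (simp add: bruhat_step_def)
    have "1 \<le> j"
      using ijkl by simp
    then show False
      using not_planar_if_321_below[OF perm bruhat_le_step[OF step refl] _ ijkl(3,4,5) less] planar by blast
  qed
  then have 2: "avoids n \<sigma> [3, 4, 1, 2]"
    unfolding avoids_3412_iff by blast
  obtain w where w: "distinct w" "set w \<subseteq> {1..<n}" "\<sigma> = wprod w"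
    using avoids_321_3412_distinct_word[OF assms 1 2] by blast
  have "length w < 4"
    using not_planar_if_long_distinct_word[OF w(1,2)] planar unfolding w(3) by linarith
  \<comment> \<open>Each of these patterns has four inversions, so a word whose product contains one
    has at least four letters.\<close>
  moreover have "4 \<le> length w" if "xs \<in> set boolean_patterns" "\<not> avoids n \<sigma> xs" for xs
  proof -
    have "inv_count xs \<le> length w"
      using that(2) unfolding avoids_def w(3) by (intro inv_count_le_length_if_contains) simp
    then show ?thesis
      using boolean_patterns_inv_count that(1) by simp
  qed
  ultimately show ?av
    using 1 2 by fastforce
qed

theorem corollary3p5:
  fixes n :: nat and \<sigma> :: "nat \<Rightarrow> nat"
  assumes "n \<ge> 1" and "\<sigma> permutes {1..n}"
  shows "planar (bruhat_graph_below n \<sigma>) \<longleftrightarrow>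
    (\<forall>xs \<in> {[3,2,1], [3,4,1,2], [2,3,4,5,1], [2,3,5,1,4],
      [2,4,1,5,3], [2,5,1,3,4], [3,1,4,5,2], [3,1,5,2,4],
      [4,1,2,5,3], [5,1,2,3,4], [2,3,4,1,6,5], [2,3,1,5,6,4],
      [2,3,1,6,4,5], [2,4,1,3,6,5], [2,1,4,5,6,3], [2,1,4,6,3,5],
      [2,1,5,3,6,4], [2,1,6,3,4,5], [3,1,4,2,6,5], [3,1,2,5,6,4],
      [3,1,2,6,4,5], [4,1,2,3,6,5], [2,3,1,5,4,7,6], [2,1,4,3,6,7,5],
      [2,1,4,3,7,5,6], [2,1,4,5,3,7,6], [2,1,5,3,4,7,6], [3,1,2,5,4,7,6],
      [2,1,4,3,6,5,8,7]}. avoids n \<sigma> xs)"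
proof -
  have "{[3,2,1], [3,4,1,2], [2,3,4,5,1], [2,3,5,1,4],
      [2,4,1,5,3], [2,5,1,3,4], [3,1,4,5,2], [3,1,5,2,4],
      [4,1,2,5,3], [5,1,2,3,4], [2,3,4,1,6,5], [2,3,1,5,6,4],
      [2,3,1,6,4,5], [2,4,1,3,6,5], [2,1,4,5,6,3], [2,1,4,6,3,5],
      [2,1,5,3,6,4], [2,1,6,3,4,5], [3,1,4,2,6,5], [3,1,2,5,6,4],
      [3,1,2,6,4,5], [4,1,2,3,6,5], [2,3,1,5,4,7,6], [2,1,4,3,6,7,5],
      [2,1,4,3,7,5,6], [2,1,4,5,3,7,6], [2,1,5,3,4,7,6], [3,1,2,5,4,7,6],
      [2,1,4,3,6,5,8,7]} = insert [3,2,1] (insert [3,4,1,2] (set boolean_patterns))"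
    unfolding boolean_patterns_def by (simp only: list.set)
  then show ?thesis
    by (simp only: ball_simps(7) planar_bruhat_graph_below_iff[OF assms(2)])
qed

end
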